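(* Let $G$ be the discrete-time LTI system $$x(k+1)=Ax(k)+B_1w(k)+B_2d(k),\quad v(k)=C_1x(k)+D_{11}w(k)+D_{12}d(k),\quad e(k)=C_2x(k)+D_{21}w(k)+D_{22}d(k),$$ with $x(k)\in\mathbb{R}^{n_x}$, $w(k),v(k)\in\mathbb{R}^m$, $d(k)\in\mathbb{R}^{n_d}$, $e(k)\in\mathbb{R}^{n_e}$. Suppose that, for some $\gamma\ge 0$ and some integer $N\ge 0$, the matrices $P^N\succeq0$ and $M^N\in\mathcal{M}_N$ satisfy $L_N(P^N,M^N,\gamma^2)\prec0$. Define $$P^{N+1}:=\begin{bmatrix} P^N & 0\\ 0 & 0\end{bmatrix},\qquad M^{N+1}:=\begin{bmatrix} M^N & 0\\ 0 & 0\end{bmatrix},$$ with zero blocks of the sizes required at horizon $N+1$. Then the inequality $L_{N+1}(P^{N+1},M^{N+1},\gamma^2)\prec0$ also holds for the same $\gamma$. Therefore any certificate feasible at horizon $N$ remains feasible at horizon $N+1$: increasing the filter horizon enlarges the admissible class of hard IQCs without imposing additional restrictions on the dissipation inequality. It follows that the optimal induced-$\ell_2$ gain bound $$\gamma_N^\star:=\inf\{\gamma\ge0:\ \exists\,P\succeq0,\ M\in\mathcal{M}_N\ \text{with}\ L_N(P,M,\gamma^2)\prec0\}\qquad(\inf\emptyset=+\infty)$$ is non-increasing as a function of the filter horizon $N$.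
   Context: The set $\mathcal{M}_N$ (the hard-IQC matrices for the repeated ReLU, i.e. the entrywise map $s\mapsto\max(s,0)$ on $\mathbb{R}^m$ applied at each time, with filter horizon $N$) consists of all real symmetric matrices of size $2m(N+1)$ of the form $$M=\begin{bmatrix} M_1 & -M_3^\top-M_1 \\ -M_3-M_1 & M_1+M_2+M_3+M_3^\top\end{bmatrix},$$ $$M_j=\begin{bmatrix} Q^j_0 & Q^j_1 & \cdots & Q^j_N \\ Q^j_1 & 0 & \cdots & 0 \\ \vdots & \vdots & & \vdots \\ Q^j_N & 0 & \cdots & 0\end{bmatrix}\ (j=1,2),\qquad M_3=\begin{bmatrix} Q^3_0 & Q^3_1 & \cdots & Q^3_N \\ Q^3_{-1} & 0 & \cdots & 0 \\ \vdots & \vdots & & \vdots \\ Q^3_{-N} & 0 & \cdots & 0\end{bmatrix},$$ where $Q^1_i,Q^2_i$ ($0\le i\le N$) and $Q^3_i$ ($1\le|i|\le N$) are $m\times m$ matrices with non-negative entries, and $Q^3_0\in\mathbb{R}^{m\times m}$ is Metzler (off-diagonal entries non-negative). Filter: $\Psi_N$ is the FIR filter with inputs $(v,w)$ and output $r(k)=[v(k)^\top,\dots,v(k-N)^\top,w(k)^\top,\dots,w(k-N)^\top]^\top$, realized by the delay line whose state $\psi(k)\in\mathbb{R}^{2mN}$ collects $v(k-1),\dots,v(k-N),w(k-1),\dots,w(k-N)$ (no state if $N=0$). Write this realization as $$\psi(k+1)=A_\psi\psi(k)+B_{\psi1}v(k)+B_{\psi2}w(k),\qquad r(k)=C_\psi\psi(k)+D_{\psi1}v(k)+D_{\psi2}w(k).$$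 The augmented system with state $\hat x=[x^\top\ \psi^\top]^\top$, inputs $(w,d)$ and outputs $(r,e)$ has matrices $$\hat A=\begin{bmatrix} A & 0 \\ B_{\psi1}C_1 & A_\psi\end{bmatrix},\ \hat B_1=\begin{bmatrix} B_1 \\ B_{\psi1}D_{11}+B_{\psi2}\end{bmatrix},\ \hat B_2=\begin{bmatrix} B_2 \\ B_{\psi1}D_{12}\end{bmatrix},$$ $$\hat C_1=\begin{bmatrix} D_{\psi1}C_1 & C_\psi\end{bmatrix},\ \hat C_2=\begin{bmatrix} C_2 & 0\end{bmatrix},\ \hat D_{11}=D_{\psi1}D_{11}+D_{\psi2},\ \hat D_{12}=D_{\psi1}D_{12},\ \hat D_{21}=D_{21},\ \hat D_{22}=D_{22},$$ all depending on $N$. For symmetric $P$ of the size of $\hat A$, define $$L_N(P,M,\gamma^2):=\begin{bmatrix} \hat A^\top P\hat A-P & \hat A^\top P\hat B_1 & \hat A^\top P\hat B_2 \\ \hat B_1^\top P\hat A & \hat B_1^\top P\hat B_1 & \hat B_1^\top P\hat B_2 \\ \hat B_2^\top P\hat A & \hat B_2^\top P\hat B_1 & \hat B_2^\top P\hat B_2-\gamma^2I\end{bmatrix}+\begin{bmatrix} \hat C_2^\top \\ \hat D_{21}^\top \\ \hat D_{22}^\top\end{bmatrix}\begin{bmatrix} \hat C_2^\top \\ \hat D_{21}^\top \\ \hat D_{22}^\top\end{bmatrix}^\top+\begin{bmatrix} \hat C_1^\top \\ \hat D_{11}^\top \\ \hat D_{12}^\top\end{bmatrix}M\begin{bmatrix}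 \hat C_1^\top \\ \hat D_{11}^\top \\ \hat D_{12}^\top\end{bmatrix}^\top .$$ $X\prec0$ ($X\succeq0$) means that the symmetric matrix $X$ is negative definite (positive semidefinite). When $L_N(P,M,\gamma^2)\prec0$ with $P\succeq0$ and $M\in\mathcal{M}_N$, and the feedback interconnection of $G$ with $w=$ repeated ReLU of $v$ is well-posed, $\gamma$ is an upper bound on the induced-$\ell_2$ gain of that interconnection from $d$ to $e$.
   Formalization: For m ≥ 1, L_{N+1} at the zero-padded P, M has zero rows at v(k-N-1), w(k-N-1), so it is never ≺ 0. Proved instead: it is ⪯ 0, strict on vectors nonzero outside these coordinates; padding P with εI (small ε > 0) gives ≺ 0. Zeros in P, M are placed at these signals. *)

theory Defs
  imports "Jordan_Normal_Form.Matrix" "HOL-Library.Extended_Real"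
begin

text \<open>All sizes vary with the horizon, so matrices are the dimension-carrying ones of
  Jordan\_Normal\_Form. Rows, columns and horizons are counted from 0.\<close>

section \<open>Block matrices and definiteness\<close>

definition append_cols :: "real mat \<Rightarrow> real mat \<Rightarrow> real mat" (infixr \<open>@c\<close> 66) where
  "A @c B = four_block_mat A B (0\<^sub>m 0 (dim_col A)) (0\<^sub>m 0 (dim_col B))"

definition neg_def :: "nat \<Rightarrow> real mat \<Rightarrow> bool" where
  "neg_def n X \<longleftrightarrow> X \<in> carrier_mat n n \<and> X\<^sup>T = X \<and>
     (\<forall>z \<in> carrier_vec n. z \<noteq> 0\<^sub>v n \<longrightarrow> z \<bullet> (X *\<^sub>v z) < 0)"

definition neg_semidef :: "nat \<Rightarrow> real mat \<Rightarrow> bool" where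
  "neg_semidef n X \<longleftrightarrow> X \<in> carrier_mat n n \<and> X\<^sup>T = X \<and>
     (\<forall>z \<in> carrier_vec n. z \<bullet> (X *\<^sub>v z) \<le> 0)"

definition pos_semidef :: "nat \<Rightarrow> real mat \<Rightarrow> bool" where
  "pos_semidef n X \<longleftrightarrow> X \<in> carrier_mat n n \<and> X\<^sup>T = X \<and>
     (\<forall>z \<in> carrier_vec n. z \<bullet> (X *\<^sub>v z) \<ge> 0)"

section \<open>Hard IQCs for the repeated ReLU\<close>

definition nonneg_mat :: "nat \<Rightarrow> real mat \<Rightarrow> bool" where
  "nonneg_mat m Q \<longleftrightarrow> Q \<in> carrier_mat m m \<and> (\<forall>i<m. \<forall>j<m. Q $$ (i, j) \<ge> 0)"

definition metzler_mat :: "nat \<Rightarrow> real mat \<Rightarrow> bool" where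
  "metzler_mat m Q \<longleftrightarrow> Q \<in> carrier_mat m m \<and> (\<forall>i<m. \<forall>j<m. i \<noteq> j \<longrightarrow> Q $$ (i, j) \<ge> 0)"

text \<open>First block row \<open>Q 0, \<dots>, Q N\<close>, first block column \<open>Q 0, Q (-1), \<dots>, Q (-N)\<close>, zero
  elsewhere; all blocks are \<open>m \<times> m\<close>.\<close>

definition arrow_mat :: "nat \<Rightarrow> nat \<Rightarrow> (int \<Rightarrow> real mat) \<Rightarrow> real mat" where
  "arrow_mat m N Q = mat (m * (N + 1)) (m * (N + 1)) (\<lambda>(i, j).
     if i div m = 0 then Q (int (j div m)) $$ (i mod m, j mod m)
     else if j div m = 0 then Q (- int (i div m)) $$ (i mod m, j mod m)
     else 0)"

definition iqc_blocks :: "real mat \<Rightarrow> real mat \<Rightarrow> real mat \<Rightarrow> real mat" where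
  "iqc_blocks M1 M2 M3 =
     four_block_mat M1 (- M3\<^sup>T - M1) (- M3 - M1) (M1 + M2 + M3 + M3\<^sup>T)"

definition relu_iqc :: "nat \<Rightarrow> nat \<Rightarrow> real mat set" where
  "relu_iqc m N = {M. M\<^sup>T = M \<and> (\<exists>(Q1 :: nat \<Rightarrow> real mat) (Q2 :: nat \<Rightarrow> real mat) (Q3 :: int \<Rightarrow> real mat).
     (\<forall>i\<le>N. nonneg_mat m (Q1 i) \<and> nonneg_mat m (Q2 i)) \<and>
     (\<forall>i. 1 \<le> \<bar>i\<bar> \<and> \<bar>i\<bar> \<le> int N \<longrightarrow> nonneg_mat m (Q3 i)) \<and>
     metzler_mat m (Q3 0) \<and>
     M = iqc_blocks (arrow_mat m N (\<lambda>i. Q1 (nat \<bar>i\<bar>))) (arrow_mat m N (\<lambda>i. Q2 (nat \<bar>i\<bar>)))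
           (arrow_mat m N Q3))}"

section \<open>The plant, the filter and the augmented system\<close>

record lti =
  nx :: nat
  nw :: nat
  nd :: nat
  ne :: nat
  matA :: "real mat"
  matB1 :: "real mat"
  matB2 :: "real mat"
  matC1 :: "real mat"
  matD11 :: "real mat"
  matD12 :: "real mat"
  matC2 :: "real mat"
  matD21 :: "real mat"
  matD22 :: "real mat"

text \<open>The signals \<open>v\<close> and \<open>w\<close> both have dimension \<open>m = nw G\<close>.\<close>

definition is_lti :: "lti \<Rightarrow> bool" where
  "is_lti G \<longleftrightarrow>
     matA G \<in> carrier_mat (nx G) (nx G) \<and> matB1 G \<in> carrier_mat (nx G) (nw G) \<and>
     matB2 G \<in> carrier_mat (nx G) (nd G) \<and>
     matC1 G \<in> carrier_mat (nw G) (nx G) \<and> matD11 G \<in> carrier_mat (nw G) (nw G) \<and>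
     matD12 G \<in> carrier_mat (nw G) (nd G) \<and>
     matC2 G \<in> carrier_mat (ne G) (nx G) \<and> matD21 G \<in> carrier_mat (ne G) (nw G) \<and>
     matD22 G \<in> carrier_mat (ne G) (nd G)"

text \<open>\<open>shift_mat r c k\<close> maps a vector to its copy moved down by \<open>k\<close> places, cut or filled with
  zeros to length \<open>r\<close>. The filter state is ordered
  \<open>v(k-1), \<dots>, v(k-N), w(k-1), \<dots>, w(k-N)\<close>, its output
  \<open>v(k), \<dots>, v(k-N), w(k), \<dots>, w(k-N)\<close>.\<close>

definition shift_mat :: "nat \<Rightarrow> nat \<Rightarrow> nat \<Rightarrow> real mat" where
  "shift_mat r c k = mat r c (\<lambda>(i, j). if i = j + k then 1 else 0)"

definition A_psi :: "nat \<Rightarrow> nat \<Rightarrow> real mat" where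
  "A_psi m N = four_block_mat (shift_mat (m * N) (m * N) m) (0\<^sub>m (m * N) (m * N))
                              (0\<^sub>m (m * N) (m * N)) (shift_mat (m * N) (m * N) m)"

definition B_psi1 :: "nat \<Rightarrow> nat \<Rightarrow> real mat" where
  "B_psi1 m N = shift_mat (m * N) m 0 @\<^sub>r 0\<^sub>m (m * N) m"

definition B_psi2 :: "nat \<Rightarrow> nat \<Rightarrow> real mat" where
  "B_psi2 m N = 0\<^sub>m (m * N) m @\<^sub>r shift_mat (m * N) m 0"

definition C_psi :: "nat \<Rightarrow> nat \<Rightarrow> real mat" where
  "C_psi m N = four_block_mat (shift_mat (m * (N + 1)) (m * N) m) (0\<^sub>m (m * (N + 1)) (m * N))
                              (0\<^sub>m (m * (N + 1)) (m * N)) (shift_mat (m * (N + 1)) (m * N) m)"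

definition D_psi1 :: "nat \<Rightarrow> nat \<Rightarrow> real mat" where
  "D_psi1 m N = shift_mat (m * (N + 1)) m 0 @\<^sub>r 0\<^sub>m (m * (N + 1)) m"

definition D_psi2 :: "nat \<Rightarrow> nat \<Rightarrow> real mat" where
  "D_psi2 m N = 0\<^sub>m (m * (N + 1)) m @\<^sub>r shift_mat (m * (N + 1)) m 0"

definition aug_dim :: "lti \<Rightarrow> nat \<Rightarrow> nat" where
  "aug_dim G N = nx G + 2 * (nw G * N)"

definition A_hat :: "lti \<Rightarrow> nat \<Rightarrow> real mat" where
  "A_hat G N = four_block_mat (matA G) (0\<^sub>m (nx G) (2 * (nw G * N)))
                              (B_psi1 (nw G) N * matC1 G) (A_psi (nw G) N)"

definition B1_hat :: "lti \<Rightarrow> nat \<Rightarrow> real mat" where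
  "B1_hat G N = matB1 G @\<^sub>r (B_psi1 (nw G) N * matD11 G + B_psi2 (nw G) N)"

definition B2_hat :: "lti \<Rightarrow> nat \<Rightarrow> real mat" where
  "B2_hat G N = matB2 G @\<^sub>r (B_psi1 (nw G) N * matD12 G)"

definition C1_hat :: "lti \<Rightarrow> nat \<Rightarrow> real mat" where
  "C1_hat G N = (D_psi1 (nw G) N * matC1 G) @c C_psi (nw G) N"

definition C2_hat :: "lti \<Rightarrow> nat \<Rightarrow> real mat" where
  "C2_hat G N = matC2 G @c 0\<^sub>m (ne G) (2 * (nw G * N))"

definition D11_hat :: "lti \<Rightarrow> nat \<Rightarrow> real mat" where
  "D11_hat G N = D_psi1 (nw G) N * matD11 G + D_psi2 (nw G) N"

definition D12_hat :: "lti \<Rightarrow> nat \<Rightarrow> real mat" where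
  "D12_hat G N = D_psi1 (nw G) N * matD12 G"

section \<open>The dissipation inequality and the optimal bound\<close>

definition lmi_dim :: "lti \<Rightarrow> nat \<Rightarrow> nat" where
  "lmi_dim G N = aug_dim G N + (nw G + nd G)"

text \<open>The last argument of \<open>lmi\<close> is \<open>\<gamma>\<^sup>2\<close>.\<close>

definition lmi :: "lti \<Rightarrow> nat \<Rightarrow> real mat \<Rightarrow> real mat \<Rightarrow> real \<Rightarrow> real mat" where
  "lmi G N P M g2 = (let
      A = A_hat G N; B1 = B1_hat G N; B2 = B2_hat G N;
      F = (C2_hat G N)\<^sup>T @\<^sub>r ((matD21 G)\<^sup>T @\<^sub>r (matD22 G)\<^sup>T);
      H = (C1_hat G N)\<^sup>T @\<^sub>r ((D11_hat G N)\<^sup>T @\<^sub>r (D12_hat G N)\<^sup>T)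
    in (((A\<^sup>T * P * A - P) @c ((A\<^sup>T * P * B1) @c (A\<^sup>T * P * B2))) @\<^sub>r
       (((B1\<^sup>T * P * A) @c ((B1\<^sup>T * P * B1) @c (B1\<^sup>T * P * B2))) @\<^sub>r
        ((B2\<^sup>T * P * A) @c ((B2\<^sup>T * P * B1) @c (B2\<^sup>T * P * B2 - g2 \<cdot>\<^sub>m 1\<^sub>m (nd G))))))
       + F * F\<^sup>T + H * M * H\<^sup>T)"

definition certificate :: "lti \<Rightarrow> nat \<Rightarrow> real \<Rightarrow> real mat \<Rightarrow> real mat \<Rightarrow> bool" where
  "certificate G N \<gamma> P M \<longleftrightarrow> pos_semidef (aug_dim G N) P \<and> M \<in> relu_iqc (nw G) N \<and>
     neg_def (lmi_dim G N) (lmi G N P M (\<gamma>\<^sup>2))"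

definition gain_bound :: "lti \<Rightarrow> nat \<Rightarrow> ereal" where
  "gain_bound G N = Inf {ereal \<gamma> | \<gamma>. \<gamma> \<ge> 0 \<and> (\<exists>P M. certificate G N \<gamma> P M)}"

section \<open>Extending a certificate to the next horizon\<close>

text \<open>The block-diagonal matrix \<open>diag(X, Z)\<close> at horizon \<open>N + 1\<close> has its lower block \<open>Z\<close> on the
  two signals \<open>v(k-N-1), w(k-N-1)\<close> that are new, whereas in the filter ordering \<open>v(k-N-1)\<close>
  precedes the delayed \<open>w\<close>. \<open>regroup s q m\<close> sends positions in the filter ordering (\<open>s\<close>
  entries of \<open>x\<close>, then \<open>q\<close> old and \<open>m\<close> new entries of \<open>v\<close>, then \<open>q\<close> old and \<open>m\<close> new entries of
  \<open>w\<close>) to positions in the ordering with the new entries last.\<close>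

definition regroup :: "nat \<Rightarrow> nat \<Rightarrow> nat \<Rightarrow> nat \<Rightarrow> nat" where
  "regroup s q m i =
     (if i < s + q then i
      else if i < s + q + m then i + q
      else if i < s + q + m + q then i - m
      else i)"

definition block_extend :: "nat \<Rightarrow> nat \<Rightarrow> nat \<Rightarrow> real mat \<Rightarrow> real mat \<Rightarrow> real mat" where
  "block_extend s q m X Z = mat (s + 2 * (q + m)) (s + 2 * (q + m)) (\<lambda>(i, j).
     four_block_mat X (0\<^sub>m (s + 2 * q) (2 * m)) (0\<^sub>m (2 * m) (s + 2 * q)) Z
       $$ (regroup s q m i, regroup s q m j))"

definition extend_P :: "lti \<Rightarrow> nat \<Rightarrow> real mat \<Rightarrow> real mat \<Rightarrow> real mat" where
  "extend_P G N P Z = block_extend (nx G) (nw G * N) (nw G) P Z"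

definition extend_M :: "lti \<Rightarrow> nat \<Rightarrow> real mat \<Rightarrow> real mat" where
  "extend_M G N M =
     block_extend 0 (nw G * (N + 1)) (nw G) M (0\<^sub>m (2 * nw G) (2 * nw G))"

text \<open>Positions of \<open>v(k-N-1)\<close> and \<open>w(k-N-1)\<close> in the augmented state at horizon \<open>N + 1\<close>.
  Pitfall: with \<open>diag(P, 0)\<close> and \<open>diag(M, 0)\<close> the quadratic form of the inequality at horizon
  \<open>N + 1\<close> does not involve these coordinates, so its matrix has zero rows and columns there and,
  for \<open>m > 0\<close>, is never negative definite, although it is negative semidefinite and strictly
  negative on every vector with a nonzero entry elsewhere. A block \<open>Z = \<epsilon> I\<close> in place of \<open>0\<close>
  with small \<open>\<epsilon> > 0\<close> in \<open>extend_P\<close> is what restores strictness.\<close>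

definition new_delays :: "lti \<Rightarrow> nat \<Rightarrow> nat set" where
  "new_delays G N =
     {nx G + nw G * N ..< nx G + nw G * (N + 1)} \<union>
     {nx G + nw G * (N + 1) + nw G * N ..< nx G + 2 * (nw G * (N + 1))}"

end

theory Submission
  imports Defs "HOL-Analysis.Function_Topology"
begin

text \<open>Write the inequality as a bilinear form in the coordinates \<open>x, v(k-1..k-N), w(k-1..k-N), w, d\<close>.
  There the filter is simply concatenation, \<open>r = (v @ pv) @ (w @ pw)\<close>, and the next filter state is
  \<open>r\<close> with the oldest samples \<open>t\<close> dropped. Passing to horizon \<open>N + 1\<close> with storage \<open>diag(P, \<epsilon> I)\<close>
  therefore changes the form by exactly \<open>\<epsilon> (|t|\<^sup>2 - |n|\<^sup>2)\<close>, \<open>n\<close> being the new coordinates. With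
  \<open>\<epsilon> = 0\<close> nothing changes. Since \<open>|t|\<^sup>2 \<le> |r|\<^sup>2\<close> is a quadratic form in the old coordinates, a small
  \<open>\<epsilon> > 0\<close> keeps the form negative there (compactness of the sphere) and makes it strictly negative
  in \<open>n\<close>.\<close>

section \<open>Perturbation of negative definite forms\<close>

text \<open>The filter lists all samples of \<open>v\<close> before those of \<open>w\<close>, so
  the new samples of \<open>v\<close> land in the middle of the state and \<open>diag(P, Z)\<close>
  is block diagonal only up to the permutation \<open>regroup\<close>. A matrix identity between the
  two horizons would carry that permutation through every block of \<open>lmi\<close>. Evaluated on
  concatenated vectors it disappears, and each comparison becomes an identity between real numbers.
  The form is kept bilinear because the symmetry of \<open>lmi\<close> is read off from it as well.
  The size of \<epsilon> is limited from one side only: the gain on the dropped samples has to fit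
  into the margin of the strict inequality at horizon \<open>N\<close>, while the loss on the new
  coordinates is strict for every \<epsilon> > 0. The resulting estimate holds for all \<epsilon>
  \<ge> 0, so the statements on zero padding and the existence of a strict certificate are two
  readings of it. Since \<gamma> never changes, the infimum can only decrease.\<close>

lemma bilinear_form_sum:
  fixes X :: "real mat"
  assumes "X \<in> carrier_mat n n" "y \<in> carrier_vec n" "z \<in> carrier_vec n"
  shows "y \<bullet> (X *\<^sub>v z) = (\<Sum>i<n. \<Sum>j<n. X $$ (i, j) * y $ i * z $ j)"
  using assms
  by (auto simp: scalar_prod_def sum_distrib_left atLeast0LessThan mult.assoc mult.left_commute
      intro!: sum.cong)

lemma scalar_prod_self_pos:
  fixes z :: "real vec"
  assumes "z \<in> carrier_vec n" "z \<noteq> 0\<^sub>v n"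
  shows "z \<bullet> z > 0"
proof -
  obtain i where i: "i < n" "z $ i \<noteq> 0"
    using assms by (metis carrier_vecD eq_vecI index_zero_vec)
  have "0 < (\<Sum>i\<in>{0..<n}. z $ i * z $ i)"
    by (rule sum_pos2[of _ i]) (use i in \<open>auto simp: zero_less_mult_iff\<close>)
  then show ?thesis using assms by (simp add: scalar_prod_def)
qed

lemma scalar_prod_self_nonneg: "(z :: real vec) \<bullet> z \<ge> 0"
  by (auto simp: scalar_prod_def intro: sum_nonneg)

text \<open>A continuous form has a maximiser on the compact unit sphere, and homogeneity of degree
  two carries the bound to every \<open>z\<close>. The factor is this maximum; for symmetric
  \<open>X\<close> it is the largest eigenvalue.\<close>

lemma quad_form_attains_max:
  fixes X :: "real mat"
  assumes X: "X \<in> carrier_mat n n" and n: "n > 0"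
  obtains u where "u \<in> carrier_vec n" "u \<noteq> 0\<^sub>v n"
    "\<And>z. z \<in> carrier_vec n \<Longrightarrow> z \<bullet> (X *\<^sub>v z) \<le> (u \<bullet> (X *\<^sub>v u)) * (z \<bullet> z)"
proof -
  \<comment> \<open>Vectors of length \<open>n\<close> become functions on \<open>nat\<close> that
    vanish from \<open>n\<close> on. The cube \<open>C\<close> is compact as a product of compact
    sets, and the sphere \<open>S\<close> is a closed part of it.\<close>
  define C :: "(nat \<Rightarrow> real) set" where "C = PiE UNIV (\<lambda>i. if i < n then {-1..1} else {0})"
  define S where "S = C \<inter> {f. (\<Sum>i<n. f i * f i) = 1}"
  define q where "q f = (\<Sum>i<n. \<Sum>j<n. X $$ (i, j) * f i * f j)" for f :: "nat \<Rightarrow> real"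
  have cont: "continuous_on A (\<lambda>f::nat \<Rightarrow> real. f i)" for A i
    by (rule continuous_on_subset[OF continuous_on_product_coordinates]) simp
  have "compactin (product_topology (\<lambda>i. euclidean) UNIV) C"
    unfolding C_def compactin_PiE by auto
  then have "compact C" by (simp add: euclidean_product_topology)
  moreover have "closed {f :: nat \<Rightarrow> real. (\<Sum>i<n. f i * f i) = 1}"
    by (intro closed_Collect_eq continuous_intros cont)
  ultimately have "compact S" unfolding S_def by (rule compact_Int_closed)
  \<comment> \<open>The first unit vector shows that \<open>S\<close> is nonempty; it exists because
    \<open>n > 0\<close>.\<close>
  moreover have "(\<lambda>i. if i = 0 then 1 else 0) \<in> S"
    using n by (auto simp: S_def C_def PiE_def if_distrib cong: if_cong)
  moreover have "continuous_on S q"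
    unfolding q_def by (intro continuous_intros cont)
  ultimately obtain f where f: "f \<in> S" "\<And>g. g \<in> S \<Longrightarrow> q g \<le> q f"
    using continuous_attains_sup[of S q] by auto
  have vq: "vec n g \<bullet> (X *\<^sub>v vec n g) = q g" for g
    by (subst bilinear_form_sum[OF X]) (auto simp: q_def)
  have vs: "vec n g \<bullet> vec n g = (\<Sum>i<n. g i * g i)" for g :: "nat \<Rightarrow> real"
    by (auto simp: scalar_prod_def atLeast0LessThan)
  show thesis
  proof
    show "vec n f \<in> carrier_vec n" by simp
    show "vec n f \<noteq> 0\<^sub>v n"
      using f(1) vs[of f] by (auto simp: S_def)
    fix z :: "real vec" assume z: "z \<in> carrier_vec n"
    show "z \<bullet> (X *\<^sub>v z) \<le> (vec n f \<bullet> (X *\<^sub>v vec n f)) * (z \<bullet> z)"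
    proof (cases "z = 0\<^sub>v n")
      case True
      have "X *\<^sub>v 0\<^sub>v n \<in> carrier_vec n" using X by simp
      then show ?thesis by (simp add: True)
    next
      case False
      define r where "r = sqrt (z \<bullet> z)"
      have r: "r > 0" "r * r = z \<bullet> z"
        using scalar_prod_self_pos[OF z False] by (auto simp: r_def)
      define g where "g i = (if i < n then z $ i / r else 0)" for i
      have zg: "z = r \<cdot>\<^sub>v vec n g" using z r by (auto simp: g_def)
      have "z \<bullet> z = r * r * (\<Sum>i<n. g i * g i)"
        unfolding zg by (simp add: vs)
      with r have g1: "(\<Sum>i<n. g i * g i) = 1" by simp
      have "-1 \<le> g i \<and> g i \<le> 1" if "i < n" for i
      proof -
        have "g i * g i \<le> (\<Sum>i<n. g i * g i)"
          by (rule member_le_sum) (use that in auto)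
        then show ?thesis using g1
          by (metis abs_le_iff abs_square_le_1 minus_le_iff power2_eq_square)
      qed
      moreover have "g i = 0" if "\<not> i < n" for i using that by (simp add: g_def)
      ultimately have "g \<in> S" using g1 by (auto simp: S_def C_def)
      then have "r * r * q g \<le> r * r * q f" using f(2) r(1) by (intro mult_left_mono) auto
      moreover have "z \<bullet> (X *\<^sub>v z) = r * r * q g"
        unfolding zg using X by (simp add: mult_mat_vec[OF X] vq)
      ultimately show ?thesis using r vq by (simp add: mult.commute)
    qed
  qed
qed

text \<open>Relative to \<open>z \<bullet> z\<close>, negative definiteness leaves a fixed margin,
  while any other form is bounded above. The range of \<epsilon> includes 0, so one \<delta> serves
  the perturbed and the unperturbed form.\<close>

lemma neg_def_perturb:
  fixes X Y :: "real mat"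
  assumes X: "neg_def n X" and Y: "Y \<in> carrier_mat n n"
  obtains \<delta> where "\<delta> > 0"
    "\<And>\<epsilon> z. 0 \<le> \<epsilon> \<Longrightarrow> \<epsilon> \<le> \<delta> \<Longrightarrow> z \<in> carrier_vec n \<Longrightarrow> z \<noteq> 0\<^sub>v n \<Longrightarrow>
       z \<bullet> (X *\<^sub>v z) + \<epsilon> * (z \<bullet> (Y *\<^sub>v z)) < 0"
proof (cases "n = 0")
  case True
  \<comment> \<open>There is no nonzero vector of length 0, so any positive \<delta> serves.\<close>
  show thesis by (rule that[of 1]) (use True in \<open>auto intro!: eq_vecI\<close>)
next
  case False
  have Xc: "X \<in> carrier_mat n n" using X by (simp add: neg_def_def)
  obtain u where u: "u \<in> carrier_vec n" "u \<noteq> 0\<^sub>v n"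
    "\<And>z. z \<in> carrier_vec n \<Longrightarrow> z \<bullet> (X *\<^sub>v z) \<le> (u \<bullet> (X *\<^sub>v u)) * (z \<bullet> z)"
    using quad_form_attains_max[OF Xc] False by blast
  obtain t where t: "\<And>z. z \<in> carrier_vec n \<Longrightarrow> z \<bullet> (Y *\<^sub>v z) \<le> (t \<bullet> (Y *\<^sub>v t)) * (z \<bullet> z)"
    using quad_form_attains_max[OF Y] False by blast
  \<comment> \<open>\<open>- a\<close> and \<open>b\<close> bound the two forms per unit of
    \<open>z \<bullet> z\<close>; the summand 1 keeps \<open>b\<close> positive for the division. Up
    to \<open>a / (2 * b)\<close> the perturbation uses at most half of the margin.\<close>
  define a where "a = - (u \<bullet> (X *\<^sub>v u))"
  define b where "b = \<bar>t \<bullet> (Y *\<^sub>v t)\<bar> + 1"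
  have a: "a > 0" and b: "b > 0" using X u by (auto simp: a_def b_def neg_def_def)
  show thesis
  proof (rule that[of "a / (2 * b)"])
    show "a / (2 * b) > 0" using a b by simp
    fix \<epsilon> and z :: "real vec"
    assume e: "0 \<le> \<epsilon>" "\<epsilon> \<le> a / (2 * b)" and z: "z \<in> carrier_vec n" "z \<noteq> 0\<^sub>v n"
    have zz: "z \<bullet> z > 0" using z by (rule scalar_prod_self_pos)
    have "z \<bullet> (Y *\<^sub>v z) \<le> b * (z \<bullet> z)"
      using t[OF z(1)] zz by (smt (verit) b_def mult_right_mono)
    then have "\<epsilon> * (z \<bullet> (Y *\<^sub>v z)) \<le> \<epsilon> * b * (z \<bullet> z)"
      using e by (simp add: mult_left_mono mult.assoc)
    also have "\<dots> \<le> (a / 2) * (z \<bullet> z)"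
      using e b zz by (intro mult_right_mono) (auto simp: field_simps)
    finally have "\<epsilon> * (z \<bullet> (Y *\<^sub>v z)) \<le> (a / 2) * (z \<bullet> z)" .
    moreover have "z \<bullet> (X *\<^sub>v z) \<le> - a * (z \<bullet> z)" using u(3)[OF z(1)] by (simp add: a_def)
    moreover have "a * (z \<bullet> z) > 0" using a zz by simp
    ultimately show "z \<bullet> (X *\<^sub>v z) + \<epsilon> * (z \<bullet> (Y *\<^sub>v z)) < 0" by simp
  qed
qed

section \<open>Extension by a diagonal block\<close>

lemma bij_betw_regroup:
  "bij_betw (regroup s q m) {..<s + 2 * (q + m)} {..<s + 2 * (q + m)}"
proof -
  have "inj_on (regroup s q m) {..<s + 2 * (q + m)}"
    by (auto simp: inj_on_def regroup_def split: if_splits)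
  moreover have "regroup s q m ` {..<s + 2 * (q + m)} \<subseteq> {..<s + 2 * (q + m)}"
    by (auto simp: regroup_def)
  ultimately show ?thesis
    by (simp add: bij_betw_def endo_inj_surj)
qed

lemma regroup_less: "i < s + 2 * (q + m) \<Longrightarrow> regroup s q m i < s + 2 * (q + m)"
  by (auto simp: regroup_def)

text \<open>Naming a position by its segment and the offset \<open>k\<close> in it lets simp
  evaluate entries of nested blocks, where the bare inequalities of \<open>regroup_def\<close> would
  leave nested conditionals.\<close>

lemma regroup_cases:
  assumes "i < s + 2 * (q + m)"
  obtains "i < s" "regroup s q m i = i"
  | k where "k < q" "i = s + k" "regroup s q m i = s + k"
  | k where "k < m" "i = s + q + k" "regroup s q m i = s + q + q + k"
  | k where "k < q" "i = s + q + m + k" "regroup s q m i = s + q + k"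
  | k where "k < m" "i = s + q + m + q + k" "regroup s q m i = s + q + q + m + k"
proof -
  consider "i < s" | "s \<le> i" "i < s + q" | "s + q \<le> i" "i < s + q + m"
    | "s + q + m \<le> i" "i < s + q + m + q" | "s + q + m + q \<le> i" by linarith
  then show thesis
  proof cases
    case 1
    then show ?thesis using that(1) by (simp add: regroup_def)
  next
    case 2
    then show ?thesis using that(2)[of "i - s"] by (simp add: regroup_def)
  next
    case 3
    then show ?thesis using that(3)[of "i - (s + q)"] by (simp add: regroup_def)
  next
    case 4
    then show ?thesis using that(4)[of "i - (s + q + m)"] by (simp add: regroup_def)
  next
    case 5
    then show ?thesis using that(5)[of "i - (s + q + m + q)"] assms by (simp add: regroup_def)
  qed
qed

lemma block_extend_carrier[simp]:
  "block_extend s q m X Z \<in> carrier_mat (s + 2 * (q + m)) (s + 2 * (q + m))"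
  by (simp add: block_extend_def)

lemma append_vec_regroup:
  assumes "x \<in> carrier_vec s" "a \<in> carrier_vec q" "b \<in> carrier_vec m" "c \<in> carrier_vec q"
    "d \<in> carrier_vec m" "i < s + 2 * (q + m)"
  shows "(x @\<^sub>v ((a @\<^sub>v b) @\<^sub>v (c @\<^sub>v d))) $ i = ((x @\<^sub>v (a @\<^sub>v c)) @\<^sub>v (b @\<^sub>v d)) $ regroup s q m i"
proof -
  note [simp] = assms(1-5)[THEN carrier_vecD]
  show ?thesis
    using assms(6) by (cases rule: regroup_cases) simp_all
qed

text \<open>The matrix is a block-diagonal one read at permuted positions, and the vectors are
  permuted alike. The permutation therefore cancels, and a block-diagonal form splits into
  two.\<close>

lemma block_extend_form:
  assumes X: "X \<in> carrier_mat (s + 2 * q) (s + 2 * q)" and Z: "Z \<in> carrier_mat (2 * m) (2 * m)"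
    and c: "x \<in> carrier_vec s" "a \<in> carrier_vec q" "b \<in> carrier_vec m" "c \<in> carrier_vec q" "d \<in> carrier_vec m"
    and c': "x' \<in> carrier_vec s" "a' \<in> carrier_vec q" "b' \<in> carrier_vec m" "c' \<in> carrier_vec q" "d' \<in> carrier_vec m"
  shows "(x @\<^sub>v ((a @\<^sub>v b) @\<^sub>v (c @\<^sub>v d))) \<bullet> (block_extend s q m X Z *\<^sub>v (x' @\<^sub>v ((a' @\<^sub>v b') @\<^sub>v (c' @\<^sub>v d'))))
    = (x @\<^sub>v (a @\<^sub>v c)) \<bullet> (X *\<^sub>v (x' @\<^sub>v (a' @\<^sub>v c'))) + (b @\<^sub>v d) \<bullet> (Z *\<^sub>v (b' @\<^sub>v d'))"
proof -
  let ?n = "s + 2 * (q + m)"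
  define F where "F = four_block_mat X (0\<^sub>m (s + 2 * q) (2 * m)) (0\<^sub>m (2 * m) (s + 2 * q)) Z"
  define u where "u = (x @\<^sub>v (a @\<^sub>v c)) @\<^sub>v (b @\<^sub>v d)"
  define u' where "u' = (x' @\<^sub>v (a' @\<^sub>v c')) @\<^sub>v (b' @\<^sub>v d')"
  let ?y = "x @\<^sub>v ((a @\<^sub>v b) @\<^sub>v (c @\<^sub>v d))" and ?y' = "x' @\<^sub>v ((a' @\<^sub>v b') @\<^sub>v (c' @\<^sub>v d'))"
  note dims = c[THEN carrier_vecD] c'[THEN carrier_vecD]
  have y: "?y \<in> carrier_vec ?n" "?y' \<in> carrier_vec ?n" "u \<in> carrier_vec ?n" "u' \<in> carrier_vec ?n"
    by (rule carrier_vecI, simp add: u_def u'_def dims)+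
  have F: "F \<in> carrier_mat ?n ?n" using X Z by (auto simp: F_def)
  have "?y \<bullet> (block_extend s q m X Z *\<^sub>v ?y') =
      (\<Sum>i<?n. \<Sum>j<?n. block_extend s q m X Z $$ (i, j) * ?y $ i * ?y' $ j)"
    by (rule bilinear_form_sum[OF block_extend_carrier y(1,2)])
  also have "\<dots> = (\<Sum>i<?n. \<Sum>j<?n. F $$ (regroup s q m i, regroup s q m j)
      * u $ regroup s q m i * u' $ regroup s q m j)"
    unfolding u_def u'_def using append_vec_regroup[OF c] append_vec_regroup[OF c']
    by (intro sum.cong refl) (simp add: block_extend_def F_def)
  also have "\<dots> = (\<Sum>i<?n. \<Sum>j<?n. F $$ (regroup s q m i, j) * u $ regroup s q m i * u' $ j)"
    by (intro sum.cong refl sum.reindex_bij_betw[OF bij_betw_regroup])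
  also have "\<dots> = (\<Sum>i<?n. \<Sum>j<?n. F $$ (i, j) * u $ i * u' $ j)"
    by (rule sum.reindex_bij_betw[OF bij_betw_regroup])
  also have "\<dots> = u \<bullet> (F *\<^sub>v u')"
    by (rule bilinear_form_sum[OF F y(3,4), symmetric])
  also have "F *\<^sub>v u' = (X *\<^sub>v (x' @\<^sub>v (a' @\<^sub>v c'))) @\<^sub>v (Z *\<^sub>v (b' @\<^sub>v d'))"
    unfolding F_def u'_def
    by (rule mult_mat_vec_split[OF X Z]) (auto intro!: carrier_vecI carrier_matI simp: dims)
  finally show ?thesis
    unfolding u_def
    by (subst (asm) scalar_prod_append[of _ "s + 2 * q" _ "2 * m"])
      (auto intro!: carrier_vecI simp: dims X[THEN carrier_matD(1)] Z[THEN carrier_matD(1)])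
qed

text \<open>Rows and columns undergo the same permutation, so the symmetry of the block-diagonal
  matrix survives.\<close>

lemma block_extend_symmetric:
  assumes X: "X \<in> carrier_mat (s + 2 * q) (s + 2 * q)" "X\<^sup>T = X"
    and Z: "Z \<in> carrier_mat (2 * m) (2 * m)" "Z\<^sup>T = Z"
  shows "(block_extend s q m X Z)\<^sup>T = block_extend s q m X Z"
proof -
  define F where "F = four_block_mat X (0\<^sub>m (s + 2 * q) (2 * m)) (0\<^sub>m (2 * m) (s + 2 * q)) Z"
  have "F\<^sup>T = F"
    unfolding F_def by (subst transpose_four_block_mat[OF X(1) _ _ Z(1)]) (use X Z in auto)
  moreover have "F \<in> carrier_mat (s + 2 * (q + m)) (s + 2 * (q + m))" using X Z by (auto simp: F_def)
  ultimately have "F $$ (i, j) = F $$ (j, i)"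
    if "i < s + 2 * (q + m)" "j < s + 2 * (q + m)" for i j
    using that by (metis carrier_matD index_transpose_mat(1))
  then have "F $$ (regroup s q m i, regroup s q m j) = F $$ (regroup s q m j, regroup s q m i)"
    if "i < s + 2 * (q + m)" "j < s + 2 * (q + m)" for i j
    using that regroup_less by blast
  then show ?thesis
    unfolding block_extend_def F_def[symmetric]
    by (intro eq_matI) simp_all
qed

section \<open>Zero padding inside the class of multipliers\<close>

lemma arrow_mat_carrier[simp]: "arrow_mat m N Q \<in> carrier_mat (m * (N + 1)) (m * (N + 1))"
  by (simp add: arrow_mat_def)

text \<open>An entry outside the old range lies in block row or block column \<open>N + 1\<close>.
  The arrow shape puts only zeros there, apart from the two tips with index \<open>N + 1\<close> and
  \<open>- (N + 1)\<close>, and these vanish by assumption.\<close>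

lemma arrow_mat_Suc:
  assumes Q: "\<And>i. \<bar>i\<bar> \<le> int N \<Longrightarrow> Q' i = Q i" "\<And>i. \<bar>i\<bar> > int N \<Longrightarrow> Q' i = 0\<^sub>m m m"
  shows "arrow_mat m (Suc N) Q' = four_block_mat (arrow_mat m N Q)
    (0\<^sub>m (m * (N + 1)) m) (0\<^sub>m m (m * (N + 1))) (0\<^sub>m m m)"
proof (intro eq_matI)
  let ?R = "four_block_mat (arrow_mat m N Q) (0\<^sub>m (m * (N + 1)) m) (0\<^sub>m m (m * (N + 1))) (0\<^sub>m m m)"
  have [simp]: "dim_row (arrow_mat m N Q) = m * (N + 1)" "dim_col (arrow_mat m N Q) = m * (N + 1)"
    by (simp_all add: arrow_mat_def)
  show "dim_row (arrow_mat m (Suc N) Q') = dim_row ?R" "dim_col (arrow_mat m (Suc N) Q') = dim_col ?R"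
    by (simp_all add: arrow_mat_def algebra_simps)
  fix i j assume "i < dim_row ?R" "j < dim_col ?R"
  then have ij: "i < m * (N + 1) + m" "j < m * (N + 1) + m" by simp_all
  \<comment> \<open>Indices within range force \<open>m > 0\<close>, so remainders modulo
    \<open>m\<close> are valid positions in the zero blocks.\<close>
  then have m: "m > 0" by (cases m) auto
  have lo: "k div m \<le> N" if "k < m * (N + 1)" for k
    using that less_mult_imp_div_less[of k "N + 1" m] by (simp add: mult.commute)
  have hi: "k div m > N" if "\<not> k < m * (N + 1)" for k
    using that div_le_mono[of "m * (N + 1)" k m] m by simp
  have "arrow_mat m (Suc N) Q' $$ (i, j) = (if i div m = 0 then Q' (int (j div m)) $$ (i mod m, j mod m)
     else if j div m = 0 then Q' (- int (i div m)) $$ (i mod m, j mod m) else 0)"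
    using ij by (simp add: arrow_mat_def algebra_simps)
  moreover have "?R $$ (i, j) = (if i < m * (N + 1) \<and> j < m * (N + 1) then arrow_mat m N Q $$ (i, j) else 0)"
    using ij by simp
  moreover have "arrow_mat m N Q $$ (i, j) = (if i div m = 0 then Q (int (j div m)) $$ (i mod m, j mod m)
     else if j div m = 0 then Q (- int (i div m)) $$ (i mod m, j mod m) else 0)"
    if "i < m * (N + 1)" "j < m * (N + 1)"
    using that by (simp add: arrow_mat_def)
  ultimately show "arrow_mat m (Suc N) Q' $$ (i, j) = ?R $$ (i, j)"
    using lo[of i] lo[of j] hi[of i] hi[of j] m Q
    by (cases "i < m * (N + 1)"; cases "j < m * (N + 1)") auto
qed

text \<open>Padding by zeros commutes with sums, negation and transposition, so it may be done
  inside each of the four blocks. In the filter ordering this is exactly the regrouped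
  \<open>diag(M, 0)\<close>; here \<open>s = 0\<close>, since the multiplier sees no plant
  state.\<close>

lemma block_extend_iqc_blocks:
  fixes q m :: nat
  defines "D \<equiv> \<lambda>X. four_block_mat X (0\<^sub>m q m) (0\<^sub>m m q) (0\<^sub>m m m)"
  assumes "M1 \<in> carrier_mat q q" "M2 \<in> carrier_mat q q" "M3 \<in> carrier_mat q q"
  shows "block_extend 0 q m (iqc_blocks M1 M2 M3) (0\<^sub>m (2 * m) (2 * m)) = iqc_blocks (D M1) (D M2) (D M3)"
proof -
  have [simp]: "dim_row M1 = q" "dim_col M1 = q" "dim_row M2 = q" "dim_col M2 = q"
     "dim_row M3 = q" "dim_col M3 = q" using assms by auto
  have D: "D X $$ (i, j) = (if i < q \<and> j < q then X $$ (i, j) else 0)"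
    if "X \<in> carrier_mat q q" "i < q + m" "j < q + m" for X i j
    using that by (auto simp: D_def)
  have [simp]: "dim_row (D X) = q + m" "dim_col (D X) = q + m" if "X \<in> carrier_mat q q" for X
    using that by (auto simp: D_def)
  show ?thesis
  proof (intro eq_matI)
    fix i j
    assume "i < dim_row (iqc_blocks (D M1) (D M2) (D M3))" "j < dim_col (iqc_blocks (D M1) (D M2) (D M3))"
    then have ij: "i < 2 * (q + m)" "j < 2 * (q + m)" using assms by (auto simp: iqc_blocks_def)
    show "block_extend 0 q m (iqc_blocks M1 M2 M3) (0\<^sub>m (2 * m) (2 * m)) $$ (i, j)
      = iqc_blocks (D M1) (D M2) (D M3) $$ (i, j)"
      by (rule regroup_cases[of i 0 q m]; (rule regroup_cases[of j 0 q m])?)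
        (use ij in \<open>simp_all add: block_extend_def iqc_blocks_def D assms(2-)\<close>)
  qed (use assms in \<open>auto simp: iqc_blocks_def block_extend_def\<close>)
qed

lemma extend_M_relu_iqc:
  assumes "M \<in> relu_iqc (nw G) N"
  shows "extend_M G N M \<in> relu_iqc (nw G) (Suc N)"
proof -
  let ?m = "nw G"
  obtain Q1 Q2 :: "nat \<Rightarrow> real mat" and Q3 :: "int \<Rightarrow> real mat" where Q:
     "\<forall>i\<le>N. nonneg_mat ?m (Q1 i) \<and> nonneg_mat ?m (Q2 i)"
     "\<forall>i. 1 \<le> \<bar>i\<bar> \<and> \<bar>i\<bar> \<le> int N \<longrightarrow> nonneg_mat ?m (Q3 i)" "metzler_mat ?m (Q3 0)"
     and M: "M = iqc_blocks (arrow_mat ?m N (\<lambda>i. Q1 (nat \<bar>i\<bar>))) (arrow_mat ?m N (\<lambda>i. Q2 (nat \<bar>i\<bar>)))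
           (arrow_mat ?m N Q3)" "M\<^sup>T = M"
    using assms by (auto simp: relu_iqc_def)
  \<comment> \<open>The block sequences are continued by zero matrices. These satisfy the sign
    constraints at index \<open>N + 1\<close>, and the Metzler condition concerns only index 0,
    which is unchanged.\<close>
  define E where "E Q k = (if k \<le> N then Q k else 0\<^sub>m ?m ?m)" for Q :: "nat \<Rightarrow> real mat" and k
  define E3 where "E3 k = (if \<bar>k\<bar> \<le> int N then Q3 k else 0\<^sub>m ?m ?m)" for k
  have Mc: "M \<in> carrier_mat (2 * (?m * (N + 1))) (2 * (?m * (N + 1)))"
    unfolding M iqc_blocks_def
    by (rule carrier_matI) (simp_all add: arrow_mat_def)
  have zero: "nonneg_mat ?m (0\<^sub>m ?m ?m)" by (simp add: nonneg_mat_def)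
  have "extend_M G N M = iqc_blocks (arrow_mat ?m (Suc N) (\<lambda>i. E Q1 (nat \<bar>i\<bar>)))
      (arrow_mat ?m (Suc N) (\<lambda>i. E Q2 (nat \<bar>i\<bar>))) (arrow_mat ?m (Suc N) E3)"
    unfolding extend_M_def M
    by (subst block_extend_iqc_blocks, (rule arrow_mat_carrier)+,
        intro arg_cong3[of _ _ _ _ _ _ iqc_blocks] arrow_mat_Suc[symmetric])
      (auto simp: E_def E3_def nat_le_iff)
  moreover have "(extend_M G N M)\<^sup>T = extend_M G N M"
    unfolding extend_M_def by (rule block_extend_symmetric) (use Mc M in auto)
  moreover have "\<forall>i\<le>Suc N. nonneg_mat ?m (E Q1 i) \<and> nonneg_mat ?m (E Q2 i)"
    using Q(1) zero by (auto simp: E_def)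
  moreover have "\<forall>i. 1 \<le> \<bar>i\<bar> \<and> \<bar>i\<bar> \<le> int (Suc N) \<longrightarrow> nonneg_mat ?m (E3 i)"
    using Q(2) zero by (auto simp: E3_def)
  moreover have "metzler_mat ?m (E3 0)" using Q(3) by (simp add: E3_def)
  ultimately show ?thesis unfolding relu_iqc_def by blast
qed

section \<open>The bilinear form of the dissipation inequality\<close>

text \<open>This rule and those below state their side conditions as equations between dimensions.
  Simp decides these by computation, whereas carrier conditions would contain sizes that the
  conclusion does not determine.\<close>

lemma scalar_prod_add_right:
  "dim_vec x = dim_vec z \<Longrightarrow> dim_vec y = dim_vec z \<Longrightarrow> (x :: real vec) \<bullet> (y + z) = x \<bullet> y + x \<bullet> z"
  by (rule scalar_prod_add_distrib[of _ "dim_vec z"]) (auto intro!: carrier_vecI carrier_matI)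

lemma scalar_prod_add_left:
  "dim_vec x = dim_vec z \<Longrightarrow> dim_vec y = dim_vec z \<Longrightarrow> ((x :: real vec) + y) \<bullet> z = x \<bullet> z + y \<bullet> z"
  by (rule add_scalar_prod_distrib[of _ "dim_vec z"]) (auto intro!: carrier_vecI carrier_matI)

lemma scalar_prod_minus_right:
  "dim_vec x = dim_vec z \<Longrightarrow> dim_vec y = dim_vec z \<Longrightarrow> (x :: real vec) \<bullet> (y - z) = x \<bullet> y - x \<bullet> z"
  by (rule scalar_prod_minus_distrib[of _ "dim_vec z"]) (auto intro!: carrier_vecI carrier_matI)

lemma scalar_prod_append_dim:
  "dim_vec a = dim_vec c \<Longrightarrow> dim_vec b = dim_vec d \<Longrightarrow>
     ((a :: real vec) @\<^sub>v b) \<bullet> (c @\<^sub>v d) = a \<bullet> c + b \<bullet> d"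
  by (rule scalar_prod_append[of _ "dim_vec a" _ "dim_vec b"]) (auto intro!: carrier_vecI carrier_matI)

lemma mult_mat_add_vec:
  "dim_vec x = dim_col A \<Longrightarrow> dim_vec y = dim_col A \<Longrightarrow>
     (A :: real mat) *\<^sub>v (x + y) = A *\<^sub>v x + A *\<^sub>v y"
  by (rule mult_add_distrib_mat_vec[of A "dim_row A" "dim_col A"]) (auto intro!: carrier_vecI carrier_matI)

lemma add_mat_mult_vec:
  "dim_row A = dim_row B \<Longrightarrow> dim_col A = dim_col B \<Longrightarrow> dim_vec x = dim_col B \<Longrightarrow>
     ((A :: real mat) + B) *\<^sub>v x = A *\<^sub>v x + B *\<^sub>v x"
  by (rule add_mult_distrib_mat_vec[of A "dim_row A" "dim_col A"]) (auto intro!: carrier_vecI carrier_matI)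

lemma minus_mat_mult_vec:
  "dim_row A = dim_row B \<Longrightarrow> dim_col A = dim_col B \<Longrightarrow> dim_vec x = dim_col B \<Longrightarrow>
     ((A :: real mat) - B) *\<^sub>v x = A *\<^sub>v x - B *\<^sub>v x"
  by (rule minus_mult_distrib_mat_vec[of A "dim_row A" "dim_col A"]) (auto intro!: carrier_vecI carrier_matI)

lemma mult_mat_mult_vec:
  "dim_col A = dim_row B \<Longrightarrow> dim_vec x = dim_col B \<Longrightarrow> ((A :: real mat) * B) *\<^sub>v x = A *\<^sub>v (B *\<^sub>v x)"
  by (rule assoc_mult_mat_vec[of A "dim_row A" "dim_col A"]) (auto intro!: carrier_vecI carrier_matI)

lemma zero_mat_mult_vec: "dim_vec x = nc \<Longrightarrow> 0\<^sub>m nr nc *\<^sub>v x = 0\<^sub>v nr" for x :: "real vec"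
  by (intro eq_vecI) (auto simp: scalar_prod_def)

lemma add_zero_vec: "dim_vec x = n \<Longrightarrow> x + 0\<^sub>v n = x" for x :: "real vec"
  by (intro eq_vecI) auto

lemma scalar_prod_transpose:
  assumes "dim_vec x = dim_col A" "dim_vec y = dim_row A"
  shows "x \<bullet> (A\<^sup>T *\<^sub>v y) = ((A :: real mat) *\<^sub>v x) \<bullet> y"
proof -
  have "x \<bullet> (A\<^sup>T *\<^sub>v y) = (A\<^sup>T *\<^sub>v y) \<bullet> x"
    by (rule comm_scalar_prod[of _ "dim_col A"]) (auto intro!: carrier_vecI carrier_matI simp: assms)
  also have "\<dots> = y \<bullet> (A *\<^sub>v x)"
    by (rule transpose_vec_mult_scalar[of _ "dim_row A" "dim_col A"])
      (auto intro!: carrier_vecI carrier_matI simp: assms)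
  also have "\<dots> = (A *\<^sub>v x) \<bullet> y"
    by (rule comm_scalar_prod[of _ "dim_row A"]) (auto intro!: carrier_vecI carrier_matI simp: assms)
  finally show ?thesis .
qed

lemma dim_append_rows_cols[simp]:
  "dim_row (A @\<^sub>r B) = dim_row A + dim_row B" "dim_col (A @\<^sub>r B) = dim_col A"
  "dim_row (A @c B) = dim_row A" "dim_col (A @c B) = dim_col A + dim_col B"
  by (simp_all add: append_rows_def append_cols_def)

lemma append_rows_mult_vec:
  "dim_col A = dim_col B \<Longrightarrow> dim_vec x = dim_col B \<Longrightarrow>
     ((A :: real mat) @\<^sub>r B) *\<^sub>v x = (A *\<^sub>v x) @\<^sub>v (B *\<^sub>v x)"
  by (rule mat_mult_append[of A "dim_row A" "dim_col A"]) (auto intro!: carrier_vecI carrier_matI)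

lemma append_cols_mult_vec:
  assumes "dim_row A = dim_row B" "dim_vec x = dim_col A" "dim_vec y = dim_col B"
  shows "(A @c B) *\<^sub>v (x @\<^sub>v y) = A *\<^sub>v x + B *\<^sub>v y"
proof -
  have "(A @c B) *\<^sub>v (x @\<^sub>v y) = (A *\<^sub>v x + B *\<^sub>v y) @\<^sub>v
      (0\<^sub>m 0 (dim_col A) *\<^sub>v x + 0\<^sub>m 0 (dim_col B) *\<^sub>v y)"
    unfolding append_cols_def
    by (rule four_block_mat_mult_vec) (auto intro!: carrier_vecI carrier_matI simp: assms)
  also have "\<dots> = A *\<^sub>v x + B *\<^sub>v y"
    by (intro eq_vecI) auto
  finally show ?thesis .
qed

lemma transpose_append_rows:
  assumes "dim_col A = dim_col B"
  shows "((A :: real mat) @\<^sub>r B)\<^sup>T = A\<^sup>T @c B\<^sup>T"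
  by (rule eq_matI) (use assms in \<open>auto simp: append_rows_def append_cols_def\<close>)

lemmas mat_vec_dim_simps = scalar_prod_add_right scalar_prod_add_left scalar_prod_minus_right
  scalar_prod_append_dim mult_mat_add_vec add_mat_mult_vec minus_mat_mult_vec mult_mat_mult_vec
  scalar_prod_transpose append_rows_mult_vec append_cols_mult_vec

text \<open>With \<open>K = [A B1 B2]\<close> the matrix is \<open>K\<^sup>T * P * K\<close> minus
  the block-diagonal matrix of \<open>P\<close>, \<open>0\<close> and \<open>g2\<close> times the
  identity, so its form is the change in storage minus the weighted input energy.\<close>

lemma storage_form:
  fixes A B1 B2 P :: "real mat"
  assumes "A \<in> carrier_mat a a" "B1 \<in> carrier_mat a m" "B2 \<in> carrier_mat a n" "P \<in> carrier_mat a a"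
    and "x \<in> carrier_vec a" "w \<in> carrier_vec m" "d \<in> carrier_vec n"
    and "x' \<in> carrier_vec a" "w' \<in> carrier_vec m" "d' \<in> carrier_vec n"
  shows "(x @\<^sub>v (w @\<^sub>v d)) \<bullet> ((((A\<^sup>T * P * A - P) @c ((A\<^sup>T * P * B1) @c (A\<^sup>T * P * B2))) @\<^sub>r
       (((B1\<^sup>T * P * A) @c ((B1\<^sup>T * P * B1) @c (B1\<^sup>T * P * B2))) @\<^sub>r
        ((B2\<^sup>T * P * A) @c ((B2\<^sup>T * P * B1) @c (B2\<^sup>T * P * B2 - g2 \<cdot>\<^sub>m 1\<^sub>m n))))) *\<^sub>v (x' @\<^sub>v (w' @\<^sub>v d')))
    = (A *\<^sub>v x + (B1 *\<^sub>v w + B2 *\<^sub>v d)) \<bullet> (P *\<^sub>v (A *\<^sub>v x' + (B1 *\<^sub>v w' + B2 *\<^sub>v d')))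
      - x \<bullet> (P *\<^sub>v x') - g2 * (d \<bullet> d')"
proof -
  note dims = assms(1-4)[THEN carrier_matD(1)] assms(1-4)[THEN carrier_matD(2)]
    assms(5-)[THEN carrier_vecD]
  have "(g2 \<cdot>\<^sub>m 1\<^sub>m n) *\<^sub>v d' = g2 \<cdot>\<^sub>v d'"
    by (intro eq_vecI) (simp_all add: dims scalar_prod_left_unit[OF assms(10)])
  then show ?thesis by (simp add: mat_vec_dim_simps dims)
qed

section \<open>The delay line as concatenation and truncation\<close>

lemma shift_mat_carrier[simp]: "shift_mat r c k \<in> carrier_mat r c"
  by (simp add: shift_mat_def)

lemma shift_mat_dim[simp]: "dim_row (shift_mat r c k) = r" "dim_col (shift_mat r c k) = c"
  by (simp_all add: shift_mat_def)

lemma shift_mat_mult_vec_index: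
  assumes "v \<in> carrier_vec c" "i < r"
  shows "(shift_mat r c k *\<^sub>v v) $ i = (if k \<le> i \<and> i < k + c then v $ (i - k) else 0)"
proof -
  have "(shift_mat r c k *\<^sub>v v) $ i = (\<Sum>j<c. if i = j + k then v $ j else 0)"
    using assms by (auto simp: shift_mat_def scalar_prod_def atLeast0LessThan intro!: sum.cong)
  also have "\<dots> = (\<Sum>j<c. if j = i - k \<and> k \<le> i then v $ j else 0)"
    by (rule sum.cong) auto
  also have "\<dots> = (if k \<le> i \<and> i < k + c then v $ (i - k) else 0)"
    by (cases "k \<le> i") auto
  finally show ?thesis .
qed

text \<open>The first summand writes \<open>v\<close> at the top, the second writes \<open>p\<close>
  just below it. The bound on \<open>r\<close> ensures that the result is only cut and never filled
  with zeros.\<close>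

lemma shift_mat_append:
  assumes "v \<in> carrier_vec m" "p \<in> carrier_vec c" "r \<le> m + c"
  shows "shift_mat r m 0 *\<^sub>v v + shift_mat r c m *\<^sub>v p = vec_first (v @\<^sub>v p) r"
  by (intro eq_vecI) (use assms in \<open>auto simp: shift_mat_mult_vec_index vec_first_def simp del: index_mult_mat_vec\<close>)

lemma psi_dims[simp]:
  "dim_row (A_psi m N) = m * N + m * N" "dim_col (A_psi m N) = m * N + m * N"
  "dim_row (B_psi1 m N) = m * N + m * N" "dim_col (B_psi1 m N) = m"
  "dim_row (B_psi2 m N) = m * N + m * N" "dim_col (B_psi2 m N) = m"
  "dim_row (C_psi m N) = m * (N + 1) + m * (N + 1)" "dim_col (C_psi m N) = m * N + m * N"
  "dim_row (D_psi1 m N) = m * (N + 1) + m * (N + 1)" "dim_col (D_psi1 m N) = m"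
  "dim_row (D_psi2 m N) = m * (N + 1) + m * (N + 1)" "dim_col (D_psi2 m N) = m"
  by (simp_all add: A_psi_def B_psi1_def B_psi2_def C_psi_def D_psi1_def D_psi2_def)

text \<open>Both filter equations are instances with \<open>c = m * N\<close>: the next state is
  \<open>r = m * N\<close>, which drops the oldest sample of each signal, and the output is
  \<open>r = m * (N + 1)\<close>, which drops nothing.\<close>

lemma stacked_shift_mult_vec:
  assumes c: "v \<in> carrier_vec m" "w \<in> carrier_vec m" "pv \<in> carrier_vec c" "pw \<in> carrier_vec c"
    and r: "r \<le> m + c"
  shows "((shift_mat r m 0 @\<^sub>r 0\<^sub>m r m) *\<^sub>v v)
     + (four_block_mat (shift_mat r c m) (0\<^sub>m r c) (0\<^sub>m r c) (shift_mat r c m) *\<^sub>v (pv @\<^sub>v pw)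
     + (0\<^sub>m r m @\<^sub>r shift_mat r m 0) *\<^sub>v w) = vec_first (v @\<^sub>v pv) r @\<^sub>v vec_first (w @\<^sub>v pw) r"
proof -
  note dims = c[THEN carrier_vecD]
  have 1: "(shift_mat r m 0 @\<^sub>r 0\<^sub>m r m) *\<^sub>v v = (shift_mat r m 0 *\<^sub>v v) @\<^sub>v 0\<^sub>v r"
    using c by (subst append_rows_mult_vec) (auto simp: dims)
  have 2: "(0\<^sub>m r m @\<^sub>r shift_mat r m 0) *\<^sub>v w = 0\<^sub>v r @\<^sub>v (shift_mat r m 0 *\<^sub>v w)"
    using c by (subst append_rows_mult_vec) (auto simp: dims)
  have 3: "four_block_mat (shift_mat r c m) (0\<^sub>m r c) (0\<^sub>m r c) (shift_mat r c m) *\<^sub>v (pv @\<^sub>v pw)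
    = (shift_mat r c m *\<^sub>v pv) @\<^sub>v (shift_mat r c m *\<^sub>v pw)"
    using c by (subst four_block_mat_mult_vec[of _ r c _ c _ r]) auto
  show ?thesis
    unfolding 1 2 3 shift_mat_append[OF c(1,3) r, symmetric] shift_mat_append[OF c(2,4) r, symmetric]
    by (intro eq_vecI) (auto simp: add.commute)
qed

section \<open>One step of the augmented system\<close>

definition plant_state :: "lti \<Rightarrow> real vec \<Rightarrow> real vec \<Rightarrow> real vec \<Rightarrow> real vec" where
  "plant_state G x w d = matA G *\<^sub>v x + (matB1 G *\<^sub>v w + matB2 G *\<^sub>v d)"

definition plant_v :: "lti \<Rightarrow> real vec \<Rightarrow> real vec \<Rightarrow> real vec \<Rightarrow> real vec" where
  "plant_v G x w d = matC1 G *\<^sub>v x + (matD11 G *\<^sub>v w + matD12 G *\<^sub>v d)"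

definition plant_e :: "lti \<Rightarrow> real vec \<Rightarrow> real vec \<Rightarrow> real vec \<Rightarrow> real vec" where
  "plant_e G x w d = matC2 G *\<^sub>v x + (matD21 G *\<^sub>v w + matD22 G *\<^sub>v d)"

lemma lti_dims:
  assumes "is_lti G"
  shows "dim_row (matA G) = nx G" "dim_col (matA G) = nx G" "dim_row (matB1 G) = nx G"
    "dim_col (matB1 G) = nw G" "dim_row (matB2 G) = nx G" "dim_col (matB2 G) = nd G"
    "dim_row (matC1 G) = nw G" "dim_col (matC1 G) = nx G" "dim_row (matD11 G) = nw G"
    "dim_col (matD11 G) = nw G" "dim_row (matD12 G) = nw G" "dim_col (matD12 G) = nd G"
    "dim_row (matC2 G) = ne G" "dim_col (matC2 G) = nx G" "dim_row (matD21 G) = ne G"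
    "dim_col (matD21 G) = nw G" "dim_row (matD22 G) = ne G" "dim_col (matD22 G) = nd G"
  using assms by (auto simp: is_lti_def)

lemma plant_carrier:
  assumes "is_lti G"
  shows "plant_state G x w d \<in> carrier_vec (nx G)" "plant_v G x w d \<in> carrier_vec (nw G)"
    "plant_e G x w d \<in> carrier_vec (ne G)"
  by (auto intro!: carrier_vecI carrier_matI simp: plant_state_def plant_v_def plant_e_def lti_dims[OF assms])

text \<open>The augmented matrices contain the plant only through products
  \<open>B * matC1 G\<close>, \<open>B * matD11 G\<close> and \<open>B * matD12 G\<close>. Taking
  out \<open>B\<close> leaves the plant output \<open>v\<close> as the input of the filter.
  \<open>B\<close> and \<open>B'\<close> stand for the \<open>v\<close> and \<open>w\<close> input
  matrices of either filter equation.\<close>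

lemma filter_input_mult_vec:
  fixes B B' K :: "real mat"
  assumes G: "is_lti G" and c: "x \<in> carrier_vec (nx G)" "w \<in> carrier_vec (nw G)" "d \<in> carrier_vec (nd G)"
      "p \<in> carrier_vec k"
    and B: "B \<in> carrier_mat r (nw G)" "B' \<in> carrier_mat r (nw G)" "K \<in> carrier_mat r k"
  shows "((B * matC1 G) *\<^sub>v x + K *\<^sub>v p) + ((B * matD11 G + B') *\<^sub>v w + (B * matD12 G) *\<^sub>v d)
    = B *\<^sub>v plant_v G x w d + (K *\<^sub>v p + B' *\<^sub>v w)"
proof -
  note dims = c[THEN carrier_vecD] B[THEN carrier_matD(1)] B[THEN carrier_matD(2)]
  have "((B * matC1 G) *\<^sub>v x + K *\<^sub>v p) + ((B * matD11 G + B') *\<^sub>v w + (B * matD12 G) *\<^sub>v d)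
    = (B *\<^sub>v (matC1 G *\<^sub>v x) + K *\<^sub>v p) +
       ((B *\<^sub>v (matD11 G *\<^sub>v w) + B' *\<^sub>v w) + B *\<^sub>v (matD12 G *\<^sub>v d))"
    by (simp add: mult_mat_mult_vec add_mat_mult_vec dims lti_dims[OF G])
  also have "\<dots> = (B *\<^sub>v (matC1 G *\<^sub>v x) + (B *\<^sub>v (matD11 G *\<^sub>v w) + B *\<^sub>v (matD12 G *\<^sub>v d)))
      + (K *\<^sub>v p + B' *\<^sub>v w)"
    by (intro eq_vecI) (simp_all add: dims)
  also have "\<dots> = B *\<^sub>v plant_v G x w d + (K *\<^sub>v p + B' *\<^sub>v w)"
    by (simp add: plant_v_def mult_mat_add_vec dims lti_dims[OF G])
  finally show ?thesis .
qed

lemma append_vec_add_dim: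
  "dim_vec a = dim_vec c \<Longrightarrow> dim_vec b = dim_vec d \<Longrightarrow>
     ((a :: real vec) @\<^sub>v b) + (c @\<^sub>v d) = (a + c) @\<^sub>v (b + d)"
  by (intro eq_vecI) auto

lemma aug_state_update:
  assumes G: "is_lti G" and c: "x \<in> carrier_vec (nx G)" "w \<in> carrier_vec (nw G)" "d \<in> carrier_vec (nd G)"
      "pv \<in> carrier_vec (nw G * N)" "pw \<in> carrier_vec (nw G * N)"
  shows "A_hat G N *\<^sub>v (x @\<^sub>v (pv @\<^sub>v pw)) + (B1_hat G N *\<^sub>v w + B2_hat G N *\<^sub>v d) =
    plant_state G x w d @\<^sub>v (vec_first (plant_v G x w d @\<^sub>v pv) (nw G * N) @\<^sub>v vec_first (w @\<^sub>v pw) (nw G * N))"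
proof -
  let ?m = "nw G" and ?q = "nw G * N" and ?p = "pv @\<^sub>v pw"
  note d = lti_dims[OF G]
  note dims = c[THEN carrier_vecD]
  have A: "A_hat G N *\<^sub>v (x @\<^sub>v ?p) = (matA G *\<^sub>v x + 0\<^sub>m (nx G) (2 * ?q) *\<^sub>v ?p) @\<^sub>v
      ((B_psi1 ?m N * matC1 G) *\<^sub>v x + A_psi ?m N *\<^sub>v ?p)"
    unfolding A_hat_def
    by (rule four_block_mat_mult_vec) (auto intro!: carrier_vecI carrier_matI simp: d dims)
  have z: "0\<^sub>m (nx G) (2 * ?q) *\<^sub>v ?p = 0\<^sub>v (nx G)"
    by (simp add: zero_mat_mult_vec dims)
  have "A_hat G N *\<^sub>v (x @\<^sub>v ?p) + (B1_hat G N *\<^sub>v w + B2_hat G N *\<^sub>v d) =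
    plant_state G x w d @\<^sub>v
      (((B_psi1 ?m N * matC1 G) *\<^sub>v x + A_psi ?m N *\<^sub>v ?p)
       + ((B_psi1 ?m N * matD11 G + B_psi2 ?m N) *\<^sub>v w + (B_psi1 ?m N * matD12 G) *\<^sub>v d))"
    unfolding A z B1_hat_def B2_hat_def plant_state_def
    by (simp add: append_rows_mult_vec append_vec_add_dim add_zero_vec d dims)
  also have "((B_psi1 ?m N * matC1 G) *\<^sub>v x + A_psi ?m N *\<^sub>v ?p)
       + ((B_psi1 ?m N * matD11 G + B_psi2 ?m N) *\<^sub>v w + (B_psi1 ?m N * matD12 G) *\<^sub>v d)
     = B_psi1 ?m N *\<^sub>v plant_v G x w d + (A_psi ?m N *\<^sub>v ?p + B_psi2 ?m N *\<^sub>v w)"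
    by (rule filter_input_mult_vec[OF G c(1-3)]) (auto intro!: carrier_vecI carrier_matI simp: d dims)
  also have "\<dots> = vec_first (plant_v G x w d @\<^sub>v pv) ?q @\<^sub>v vec_first (w @\<^sub>v pw) ?q"
    unfolding B_psi1_def A_psi_def B_psi2_def
    by (rule stacked_shift_mult_vec) (use c plant_carrier[OF G] in auto)
  finally show ?thesis .
qed

lemma aug_filter_output:
  assumes G: "is_lti G" and c: "x \<in> carrier_vec (nx G)" "w \<in> carrier_vec (nw G)" "d \<in> carrier_vec (nd G)"
      "pv \<in> carrier_vec (nw G * N)" "pw \<in> carrier_vec (nw G * N)"
  shows "C1_hat G N *\<^sub>v (x @\<^sub>v (pv @\<^sub>v pw)) + (D11_hat G N *\<^sub>v w + D12_hat G N *\<^sub>v d) =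
    (plant_v G x w d @\<^sub>v pv) @\<^sub>v (w @\<^sub>v pw)"
proof -
  let ?m = "nw G" and ?p = "pv @\<^sub>v pw" and ?r = "nw G * (N + 1)"
  note d = lti_dims[OF G]
  note dims = c[THEN carrier_vecD]
  have "C1_hat G N *\<^sub>v (x @\<^sub>v ?p) + (D11_hat G N *\<^sub>v w + D12_hat G N *\<^sub>v d)
     = ((D_psi1 ?m N * matC1 G) *\<^sub>v x + C_psi ?m N *\<^sub>v ?p)
       + ((D_psi1 ?m N * matD11 G + D_psi2 ?m N) *\<^sub>v w + (D_psi1 ?m N * matD12 G) *\<^sub>v d)"
    unfolding C1_hat_def D11_hat_def D12_hat_def
    by (subst append_cols_mult_vec) (simp_all add: d dims)
  also have "\<dots> = D_psi1 ?m N *\<^sub>v plant_v G x w d + (C_psi ?m N *\<^sub>v ?p + D_psi2 ?m N *\<^sub>v w)"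
    by (rule filter_input_mult_vec[OF G c(1-3)]) (auto intro!: carrier_vecI carrier_matI simp: d dims)
  also have "\<dots> = vec_first (plant_v G x w d @\<^sub>v pv) ?r @\<^sub>v vec_first (w @\<^sub>v pw) ?r"
    unfolding D_psi1_def C_psi_def D_psi2_def
    by (rule stacked_shift_mult_vec) (use c plant_carrier[OF G] in auto)
  \<comment> \<open>The cut at \<open>m * (N + 1)\<close> is the full length, so nothing is
    removed.\<close>
  also have "vec_first (plant_v G x w d @\<^sub>v pv) ?r = plant_v G x w d @\<^sub>v pv"
    using plant_carrier(2)[OF G, of x w d] by (intro eq_vecI) (auto simp: vec_first_def dims)
  also have "vec_first (w @\<^sub>v pw) ?r = w @\<^sub>v pw"
    by (intro eq_vecI) (auto simp: vec_first_def dims)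
  finally show ?thesis .
qed

section \<open>The inequality evaluated on concatenated vectors\<close>

lemma hat_dims:
  assumes "is_lti G"
  shows "A_hat G N \<in> carrier_mat (aug_dim G N) (aug_dim G N)" "B1_hat G N \<in> carrier_mat (aug_dim G N) (nw G)"
    "B2_hat G N \<in> carrier_mat (aug_dim G N) (nd G)"
    "C1_hat G N \<in> carrier_mat (2 * (nw G * (N + 1))) (aug_dim G N)"
    "D11_hat G N \<in> carrier_mat (2 * (nw G * (N + 1))) (nw G)"
    "D12_hat G N \<in> carrier_mat (2 * (nw G * (N + 1))) (nd G)"
    "C2_hat G N \<in> carrier_mat (ne G) (aug_dim G N)"
  by (auto intro!: carrier_matI simp: lti_dims[OF assms] A_hat_def B1_hat_def B2_hat_def C1_hat_def
      D11_hat_def D12_hat_def C2_hat_def aug_dim_def)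

text \<open>Each summand of \<open>lmi\<close> is a congruence by a map of the augmented system:
  next state for \<open>P\<close>, output \<open>e\<close> for the identity, filter output
  \<open>r\<close> for \<open>M\<close>. Two independent arguments are allowed so that symmetry can
  be derived from it.\<close>

lemma lmi_form:
  assumes G: "is_lti G" and P: "P \<in> carrier_mat (aug_dim G N) (aug_dim G N)"
    and M: "M \<in> carrier_mat (2 * (nw G * (N + 1))) (2 * (nw G * (N + 1)))"
    and c: "x \<in> carrier_vec (nx G)" "w \<in> carrier_vec (nw G)" "d \<in> carrier_vec (nd G)"
      "pv \<in> carrier_vec (nw G * N)" "pw \<in> carrier_vec (nw G * N)"
    and c': "x' \<in> carrier_vec (nx G)" "w' \<in> carrier_vec (nw G)" "d' \<in> carrier_vec (nd G)"
      "pv' \<in> carrier_vec (nw G * N)" "pw' \<in> carrier_vec (nw G * N)"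
  shows "((x @\<^sub>v (pv @\<^sub>v pw)) @\<^sub>v (w @\<^sub>v d)) \<bullet> (lmi G N P M g2 *\<^sub>v ((x' @\<^sub>v (pv' @\<^sub>v pw')) @\<^sub>v (w' @\<^sub>v d')))
   = (plant_state G x w d @\<^sub>v (vec_first (plant_v G x w d @\<^sub>v pv) (nw G * N) @\<^sub>v vec_first (w @\<^sub>v pw) (nw G * N)))
     \<bullet> (P *\<^sub>v (plant_state G x' w' d' @\<^sub>v
         (vec_first (plant_v G x' w' d' @\<^sub>v pv') (nw G * N) @\<^sub>v vec_first (w' @\<^sub>v pw') (nw G * N))))
     - (x @\<^sub>v (pv @\<^sub>v pw)) \<bullet> (P *\<^sub>v (x' @\<^sub>v (pv' @\<^sub>v pw')))
     - g2 * (d \<bullet> d') + plant_e G x w d \<bullet> plant_e G x' w' d'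
     + ((plant_v G x w d @\<^sub>v pv) @\<^sub>v (w @\<^sub>v pw)) \<bullet> (M *\<^sub>v ((plant_v G x' w' d' @\<^sub>v pv') @\<^sub>v (w' @\<^sub>v pw')))"
proof -
  let ?a = "aug_dim G N" and ?r = "2 * (nw G * (N + 1))"
  define y where "y = x @\<^sub>v (pv @\<^sub>v pw)"
  define y' where "y' = x' @\<^sub>v (pv' @\<^sub>v pw')"
  define z where "z = y @\<^sub>v (w @\<^sub>v d)"
  define z' where "z' = y' @\<^sub>v (w' @\<^sub>v d')"
  define F where "F = (C2_hat G N)\<^sup>T @\<^sub>r ((matD21 G)\<^sup>T @\<^sub>r (matD22 G)\<^sup>T)"
  define H where "H = (C1_hat G N)\<^sup>T @\<^sub>r ((D11_hat G N)\<^sup>T @\<^sub>r (D12_hat G N)\<^sup>T)"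
  define A where "A = A_hat G N" define B1 where "B1 = B1_hat G N" define B2 where "B2 = B2_hat G N"
  define S where "S = (((A\<^sup>T * P * A - P) @c ((A\<^sup>T * P * B1) @c (A\<^sup>T * P * B2))) @\<^sub>r
       (((B1\<^sup>T * P * A) @c ((B1\<^sup>T * P * B1) @c (B1\<^sup>T * P * B2))) @\<^sub>r
        ((B2\<^sup>T * P * A) @c ((B2\<^sup>T * P * B1) @c (B2\<^sup>T * P * B2 - g2 \<cdot>\<^sub>m 1\<^sub>m (nd G))))))"
  note h = hat_dims[OF G, of N]
  note hd = h[THEN carrier_matD(1)] h[THEN carrier_matD(2)] lti_dims[OF G]
  note dP = P[THEN carrier_matD(1)] P[THEN carrier_matD(2)] M[THEN carrier_matD(1)] M[THEN carrier_matD(2)]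
  note dims = c[THEN carrier_vecD] c'[THEN carrier_vecD]
  have dy: "dim_vec y = ?a" "dim_vec y' = ?a" by (simp_all add: y_def y'_def dims aug_dim_def)
  have dz: "dim_vec z = lmi_dim G N" "dim_vec z' = lmi_dim G N"
    by (simp_all add: z_def z'_def dims dy lmi_dim_def)
  have dF: "dim_row F = lmi_dim G N" "dim_col F = ne G" "dim_row H = lmi_dim G N" "dim_col H = ?r"
    "dim_row S = lmi_dim G N" "dim_col S = lmi_dim G N"
    by (simp_all add: F_def H_def S_def A_def B1_def B2_def hd dP lmi_dim_def)
  have L: "lmi G N P M g2 = S + F * F\<^sup>T + H * M * H\<^sup>T"
    by (simp add: lmi_def Let_def S_def F_def H_def A_def B1_def B2_def)
  \<comment> \<open>\<open>F\<close> and \<open>H\<close> stack transposed output matrices, so their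
    transposes are the output maps that send \<open>z\<close> to \<open>e\<close> and to
    \<open>r\<close>.\<close>
  have FT: "F\<^sup>T = C2_hat G N @c (matD21 G @c matD22 G)" "H\<^sup>T = C1_hat G N @c (D11_hat G N @c D12_hat G N)"
    by (simp_all add: F_def H_def transpose_append_rows hd)
  have F': "F\<^sup>T *\<^sub>v z = plant_e G x w d" "F\<^sup>T *\<^sub>v z' = plant_e G x' w' d'"
    unfolding FT z_def z'_def y_def y'_def plant_e_def C2_hat_def
    by (simp_all add: append_cols_mult_vec dims hd aug_dim_def zero_mat_mult_vec add_zero_vec)
  have H': "H\<^sup>T *\<^sub>v z = (plant_v G x w d @\<^sub>v pv) @\<^sub>v (w @\<^sub>v pw)"
     "H\<^sup>T *\<^sub>v z' = (plant_v G x' w' d' @\<^sub>v pv') @\<^sub>v (w' @\<^sub>v pw')"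
    unfolding aug_filter_output[OF G c, symmetric] aug_filter_output[OF G c', symmetric] FT z_def z'_def
    by (simp_all add: append_cols_mult_vec dims hd dy y_def y'_def aug_dim_def)
  have "z \<bullet> (lmi G N P M g2 *\<^sub>v z') = z \<bullet> (S *\<^sub>v z') + z \<bullet> (F *\<^sub>v (F\<^sup>T *\<^sub>v z'))
      + z \<bullet> (H *\<^sub>v (M *\<^sub>v (H\<^sup>T *\<^sub>v z')))"
    unfolding L by (simp add: mat_vec_dim_simps dF dz dP)
  also have "z \<bullet> (F *\<^sub>v (F\<^sup>T *\<^sub>v z')) = plant_e G x w d \<bullet> plant_e G x' w' d'"
    using scalar_prod_transpose[of z "F\<^sup>T" "F\<^sup>T *\<^sub>v z'"] by (simp add: F' dF dz plant_carrier(3)[OF G, THEN carrier_vecD])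
  also have "z \<bullet> (H *\<^sub>v (M *\<^sub>v (H\<^sup>T *\<^sub>v z'))) = (H\<^sup>T *\<^sub>v z) \<bullet> (M *\<^sub>v (H\<^sup>T *\<^sub>v z'))"
    using scalar_prod_transpose[of z "H\<^sup>T" "M *\<^sub>v (H\<^sup>T *\<^sub>v z')"] by (simp add: dF dz dP)
  also have "z \<bullet> (S *\<^sub>v z') = (A *\<^sub>v y + (B1 *\<^sub>v w + B2 *\<^sub>v d)) \<bullet> (P *\<^sub>v (A *\<^sub>v y' + (B1 *\<^sub>v w' + B2 *\<^sub>v d')))
      - y \<bullet> (P *\<^sub>v y') - g2 * (d \<bullet> d')"
    unfolding S_def z_def z'_def A_def B1_def B2_def
    by (rule storage_form[OF h(1-3) P _ c(2,3) _ c'(2,3)]) (auto intro: carrier_vecI simp: dy)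
  finally show ?thesis
    unfolding H' A_def B1_def B2_def
    unfolding z_def z'_def y_def y'_def aug_state_update[OF G c] aug_state_update[OF G c'] by simp
qed

section \<open>Passing to the next horizon\<close>

text \<open>Unit vectors recover the entries from the form. This reduces the symmetry of
  \<open>lmi\<close> to \<open>lmi_form\<close>, without transposing a product of blocks.\<close>

lemma symmetric_matI:
  fixes L :: "real mat"
  assumes L: "L \<in> carrier_mat n n"
    and sym: "\<And>y z. y \<in> carrier_vec n \<Longrightarrow> z \<in> carrier_vec n \<Longrightarrow> y \<bullet> (L *\<^sub>v z) = z \<bullet> (L *\<^sub>v y)"
  shows "L\<^sup>T = L"
proof -
  have entry: "unit_vec n i \<bullet> (L *\<^sub>v unit_vec n j) = L $$ (i, j)" if "i < n" "j < n" for i j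
  proof -
    have "L *\<^sub>v unit_vec n j \<in> carrier_vec n" using L by simp
    then show ?thesis using L that by (simp add: scalar_prod_left_unit)
  qed
  show ?thesis
  proof (rule eq_matI)
    fix i j assume "i < dim_row L" "j < dim_col L"
    then have "i < n" "j < n" using L by auto
    then show "L\<^sup>T $$ (i, j) = L $$ (i, j)"
      using entry[of i j] entry[of j i] sym[of "unit_vec n i" "unit_vec n j"] L by simp
  qed (use L in auto)
qed

lemma symmetric_form_commute:
  fixes P :: "real mat"
  assumes "P \<in> carrier_mat n n" "P\<^sup>T = P" "y \<in> carrier_vec n" "z \<in> carrier_vec n"
  shows "y \<bullet> (P *\<^sub>v z) = z \<bullet> (P *\<^sub>v y)"
proof -
  have "y \<bullet> (P *\<^sub>v z) = (P *\<^sub>v y) \<bullet> z"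
    using scalar_prod_transpose[of y P z] assms by simp
  also have "\<dots> = z \<bullet> (P *\<^sub>v y)"
    by (rule comm_scalar_prod[of _ n]) (use assms in auto)
  finally show ?thesis .
qed

lemma carrier_vec_splitE:
  assumes "z \<in> carrier_vec (a + b)"
  obtains u t where "u \<in> carrier_vec a" "t \<in> carrier_vec b" "z = u @\<^sub>v t"
  using that[of "vec_first z a" "vec_last z b"] assms by simp

lemma lmi_vec_splitE:
  assumes "z \<in> carrier_vec (lmi_dim G N)"
  obtains x pv pw w d where "x \<in> carrier_vec (nx G)" "w \<in> carrier_vec (nw G)" "d \<in> carrier_vec (nd G)"
    "pv \<in> carrier_vec (nw G * N)" "pw \<in> carrier_vec (nw G * N)"
    "z = (x @\<^sub>v (pv @\<^sub>v pw)) @\<^sub>v (w @\<^sub>v d)"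
proof -
  have "z \<in> carrier_vec ((nx G + (nw G * N + nw G * N)) + (nw G + nd G))"
    using assms by (simp add: lmi_dim_def aug_dim_def mult_2)
  then show thesis by (metis carrier_vec_splitE that)
qed

lemma lmi_carrier:
  assumes "is_lti G"
  shows "lmi G N P M g2 \<in> carrier_mat (lmi_dim G N) (lmi_dim G N)"
  unfolding lmi_def Let_def
  by (rule carrier_matI)
    (simp_all add: hat_dims[OF assms, THEN carrier_matD(1)] hat_dims[OF assms, THEN carrier_matD(2)]
      lti_dims[OF assms] lmi_dim_def)

text \<open>After evaluation by \<open>lmi_form\<close> the two sides agree term by term: the terms
  in \<open>P\<close> and \<open>M\<close> by their symmetry, the terms in \<open>d\<close> and
  \<open>e\<close> because the scalar product commutes.\<close>

lemma lmi_symmetric: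
  assumes G: "is_lti G" and P: "P \<in> carrier_mat (aug_dim G N) (aug_dim G N)" "P\<^sup>T = P"
    and M: "M \<in> carrier_mat (2 * (nw G * (N + 1))) (2 * (nw G * (N + 1)))" "M\<^sup>T = M"
  shows "(lmi G N P M g2)\<^sup>T = lmi G N P M g2"
proof (rule symmetric_matI[OF lmi_carrier[OF G]])
  fix y z :: "real vec" assume "y \<in> carrier_vec (lmi_dim G N)" "z \<in> carrier_vec (lmi_dim G N)"
  then obtain x pv pw w d x' pv' pw' w' d' where
    c: "x \<in> carrier_vec (nx G)" "w \<in> carrier_vec (nw G)" "d \<in> carrier_vec (nd G)"
      "pv \<in> carrier_vec (nw G * N)" "pw \<in> carrier_vec (nw G * N)"
    and c': "x' \<in> carrier_vec (nx G)" "w' \<in> carrier_vec (nw G)" "d' \<in> carrier_vec (nd G)"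
      "pv' \<in> carrier_vec (nw G * N)" "pw' \<in> carrier_vec (nw G * N)"
    and yz: "y = (x @\<^sub>v (pv @\<^sub>v pw)) @\<^sub>v (w @\<^sub>v d)" "z = (x' @\<^sub>v (pv' @\<^sub>v pw')) @\<^sub>v (w' @\<^sub>v d')"
    by (metis lmi_vec_splitE)
  note dims = c[THEN carrier_vecD] c'[THEN carrier_vecD] plant_carrier[OF G, THEN carrier_vecD]
  note comm = symmetric_form_commute[OF P] symmetric_form_commute[OF M]
    comm_scalar_prod[OF c(3) c'(3)] comm_scalar_prod[OF plant_carrier(3)[OF G] plant_carrier(3)[OF G]]
  show "y \<bullet> (lmi G N P M g2 *\<^sub>v z) = z \<bullet> (lmi G N P M g2 *\<^sub>v y)"
    unfolding yz lmi_form[OF G P(1) M(1) c c'] lmi_form[OF G P(1) M(1) c' c]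
    by (intro arg_cong2[of _ _ _ _ "(+)"] arg_cong2[of _ _ _ _ "(-)"] comm
        arg_cong[of _ _ "\<lambda>t. g2 * t"])
      (auto intro!: carrier_vecI simp: dims aug_dim_def)
qed

section \<open>The forms at two consecutive horizons compared\<close>

lemma append_vec_assoc: "a @\<^sub>v (b @\<^sub>v c) = (a @\<^sub>v b) @\<^sub>v (c :: real vec)"
  by (intro eq_vecI) auto

lemma vec_first_append: "dim_vec a = n \<Longrightarrow> vec_first (a @\<^sub>v b) n = (a :: real vec)"
  by (intro eq_vecI) (auto simp: vec_first_def)

lemma smult_one_form: "dim_vec t = n \<Longrightarrow> dim_vec u = n \<Longrightarrow>
  u \<bullet> ((\<epsilon> \<cdot>\<^sub>m 1\<^sub>m n) *\<^sub>v t) = \<epsilon> * (u \<bullet> t)" for t u :: "real vec"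
proof -
  assume d: "dim_vec t = n" "dim_vec u = n"
  have "t \<in> carrier_vec n" using d by (intro carrier_vecI)
  then have "(\<epsilon> \<cdot>\<^sub>m 1\<^sub>m n) *\<^sub>v t = \<epsilon> \<cdot>\<^sub>v t"
    by (intro eq_vecI) (simp_all add: d)
  then show ?thesis by (simp add: d)
qed

lemma zero_mat_form: "dim_vec t = n \<Longrightarrow> dim_vec u = n \<Longrightarrow> u \<bullet> (0\<^sub>m n n *\<^sub>v t) = 0" for t u :: "real vec"
  by (simp add: zero_mat_mult_vec) (auto simp: scalar_prod_def)

lemma block_extend_smult_one_form:
  fixes \<epsilon> :: real
  assumes X: "X \<in> carrier_mat (s + 2 * q) (s + 2 * q)"
    and c: "x \<in> carrier_vec s" "a \<in> carrier_vec q" "b \<in> carrier_vec m" "c \<in> carrier_vec q" "d \<in> carrier_vec m"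
  shows "(x @\<^sub>v ((a @\<^sub>v b) @\<^sub>v (c @\<^sub>v d))) \<bullet>
      (block_extend s q m X (\<epsilon> \<cdot>\<^sub>m 1\<^sub>m (2 * m)) *\<^sub>v (x @\<^sub>v ((a @\<^sub>v b) @\<^sub>v (c @\<^sub>v d))))
    = (x @\<^sub>v (a @\<^sub>v c)) \<bullet> (X *\<^sub>v (x @\<^sub>v (a @\<^sub>v c))) + \<epsilon> * ((b @\<^sub>v d) \<bullet> (b @\<^sub>v d))"
proof -
  have Z: "\<epsilon> \<cdot>\<^sub>m 1\<^sub>m (2 * m) \<in> carrier_mat (2 * m) (2 * m)" by simp
  have "(b @\<^sub>v d) \<bullet> ((\<epsilon> \<cdot>\<^sub>m 1\<^sub>m (2 * m)) *\<^sub>v (b @\<^sub>v d)) = \<epsilon> * ((b @\<^sub>v d) \<bullet> (b @\<^sub>v d))"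
    by (rule smult_one_form) (simp_all add: c[THEN carrier_vecD])
  then show ?thesis unfolding block_extend_form[OF X Z c c] by simp
qed

text \<open>The storage weight \<open>\<epsilon>\<close> on the new delays collects what drops out of the old delay line,
  \<open>t\<close>, and pays with what was stored in the new one.\<close>

lemma lmi_extend_form:
  fixes \<epsilon> :: real
  assumes G: "is_lti G" and P: "P \<in> carrier_mat (aug_dim G N) (aug_dim G N)"
    and M: "M \<in> carrier_mat (2 * (nw G * (N + 1))) (2 * (nw G * (N + 1)))"
    and c: "x \<in> carrier_vec (nx G)" "w \<in> carrier_vec (nw G)" "d \<in> carrier_vec (nd G)"
      "pv \<in> carrier_vec (nw G * N)" "pw \<in> carrier_vec (nw G * N)"
    and n: "nv \<in> carrier_vec (nw G)" "nu \<in> carrier_vec (nw G)"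
  defines "t \<equiv> vec_last (plant_v G x w d @\<^sub>v pv) (nw G) @\<^sub>v vec_last (w @\<^sub>v pw) (nw G)"
    and "z \<equiv> (x @\<^sub>v (pv @\<^sub>v pw)) @\<^sub>v (w @\<^sub>v d)"
    and "z' \<equiv> (x @\<^sub>v ((pv @\<^sub>v nv) @\<^sub>v (pw @\<^sub>v nu))) @\<^sub>v (w @\<^sub>v d)"
  shows "z' \<bullet> (lmi G (Suc N) (extend_P G N P (\<epsilon> \<cdot>\<^sub>m 1\<^sub>m (2 * nw G))) (extend_M G N M) g2 *\<^sub>v z') =
    z \<bullet> (lmi G N P M g2 *\<^sub>v z) + \<epsilon> * (t \<bullet> t) - \<epsilon> * ((nv @\<^sub>v nu) \<bullet> (nv @\<^sub>v nu))"
proof -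
  let ?m = "nw G" and ?q = "nw G * N" and ?Z = "\<epsilon> \<cdot>\<^sub>m 1\<^sub>m (2 * nw G)"
  define v where "v = plant_v G x w d"
  define s where "s = plant_state G x w d"
  define fv where "fv = vec_first (v @\<^sub>v pv) ?q"
  define fw where "fw = vec_first (w @\<^sub>v pw) ?q"
  define tv where "tv = vec_last (v @\<^sub>v pv) ?m"
  define tw where "tw = vec_last (w @\<^sub>v pw) ?m"
  have cv: "v \<in> carrier_vec ?m" "s \<in> carrier_vec (nx G)"
    using plant_carrier[OF G] by (simp_all add: v_def s_def)
  have cf: "fv \<in> carrier_vec ?q" "fw \<in> carrier_vec ?q" "tv \<in> carrier_vec ?m" "tw \<in> carrier_vec ?m"
    by (simp_all add: fv_def fw_def tv_def tw_def)
  note dims = c[THEN carrier_vecD] n[THEN carrier_vecD] cv[THEN carrier_vecD] cf[THEN carrier_vecD]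
  \<comment> \<open>Each window of \<open>N + 1\<close> samples is cut in two ways: current sample
    and past, or retained part and oldest sample.\<close>
  have split: "v @\<^sub>v pv = fv @\<^sub>v tv" "w @\<^sub>v pw = fw @\<^sub>v tw"
    unfolding fv_def fw_def tv_def tw_def
    by (rule vec_first_last_append[symmetric], rule carrier_vecI, simp add: dims)+
  have P1: "P \<in> carrier_mat (nx G + 2 * ?q) (nx G + 2 * ?q)" using P by (simp add: aug_dim_def)
  have Pe: "extend_P G N P ?Z \<in> carrier_mat (aug_dim G (Suc N)) (aug_dim G (Suc N))"
    unfolding extend_P_def aug_dim_def
    using block_extend_carrier[of "nx G" ?q ?m P ?Z] by (simp add: algebra_simps)
  have Me: "extend_M G N M \<in> carrier_mat (2 * (?m * (Suc N + 1))) (2 * (?m * (Suc N + 1)))"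
    unfolding extend_M_def
    using block_extend_carrier[of 0 "?m * (N + 1)" ?m M "0\<^sub>m (2 * ?m) (2 * ?m)"] by (simp add: algebra_simps)
  have cn: "pv @\<^sub>v nv \<in> carrier_vec (?m * Suc N)" "pw @\<^sub>v nu \<in> carrier_vec (?m * Suc N)"
    by (rule carrier_vecI, simp add: dims)+
  \<comment> \<open>The longer delay line drops \<open>nv\<close> and \<open>nu\<close> and moves
    \<open>tv\<close> and \<open>tw\<close> into their slots. Hence the next state carries the
    weight \<epsilon> on \<open>t\<close>, and the current one carries it on the new
    coordinates.\<close>
  have first: "vec_first (v @\<^sub>v (pv @\<^sub>v nv)) (?m * Suc N) = fv @\<^sub>v tv"
     "vec_first (w @\<^sub>v (pw @\<^sub>v nu)) (?m * Suc N) = fw @\<^sub>v tw"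
    unfolding append_vec_assoc split by (rule vec_first_append, simp add: dims)+
  note formP = block_extend_smult_one_form[where m = ?m, OF P1, folded extend_P_def]
  let ?r = "(v @\<^sub>v pv) @\<^sub>v (w @\<^sub>v pw)"
    and ?r' = "(v @\<^sub>v (pv @\<^sub>v nv)) @\<^sub>v (w @\<^sub>v (pw @\<^sub>v nu))"
  \<comment> \<open>The multiplier acts on the filter output alone, so the leading segment of
    \<open>block_extend\<close> is the empty vector.\<close>
  have M1: "M \<in> carrier_mat (0 + 2 * (?m * (N + 1))) (0 + 2 * (?m * (N + 1)))" using M by simp
  have cM: "vNil \<in> carrier_vec 0" "v @\<^sub>v pv \<in> carrier_vec (?m * (N + 1))" "nv \<in> carrier_vec ?m"
    "w @\<^sub>v pw \<in> carrier_vec (?m * (N + 1))" "nu \<in> carrier_vec ?m"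
    using n by (auto intro!: carrier_vecI simp: dims)
  have "(vNil @\<^sub>v (((v @\<^sub>v pv) @\<^sub>v nv) @\<^sub>v ((w @\<^sub>v pw) @\<^sub>v nu))) \<bullet>
    (extend_M G N M *\<^sub>v (vNil @\<^sub>v (((v @\<^sub>v pv) @\<^sub>v nv) @\<^sub>v ((w @\<^sub>v pw) @\<^sub>v nu))))
    = (vNil @\<^sub>v ?r) \<bullet> (M *\<^sub>v (vNil @\<^sub>v ?r)) + 0"
    unfolding extend_M_def block_extend_form[OF M1 zero_carrier_mat cM cM]
    by (subst zero_mat_form) (simp_all add: dims)
  then have formM: "?r' \<bullet> (extend_M G N M *\<^sub>v ?r') = ?r \<bullet> (M *\<^sub>v ?r)"
    by (simp add: append_vec_assoc)
  show ?thesis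
    unfolding z_def z'_def t_def
      lmi_form[OF G Pe Me c(1-3) cn c(1-3) cn] lmi_form[OF G P M c c]
    unfolding v_def[symmetric] s_def[symmetric] first formM
      formP[OF cv(2) cf(1,3,2,4)] formP[OF c(1) c(4) n(1) c(5) n(2)]
    unfolding fv_def[symmetric] fw_def[symmetric] tv_def[symmetric] tw_def[symmetric]
    by simp
qed

text \<open>Supplies the perturbation for \<open>neg_def_perturb\<close>: the squared length of the
  filter output as a form in the old coordinates. The matrix is \<open>H * H\<^sup>T\<close> with
  the \<open>H\<close> of \<open>lmi\<close>; writing it as a difference of two instances of
  \<open>lmi\<close> lets \<open>lmi_form\<close> evaluate it.\<close>

lemma filter_output_form:
  assumes G: "is_lti G"
  obtains Y where "Y \<in> carrier_mat (lmi_dim G N) (lmi_dim G N)"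
    "\<And>x w d pv pw. x \<in> carrier_vec (nx G) \<Longrightarrow> w \<in> carrier_vec (nw G) \<Longrightarrow> d \<in> carrier_vec (nd G) \<Longrightarrow>
       pv \<in> carrier_vec (nw G * N) \<Longrightarrow> pw \<in> carrier_vec (nw G * N) \<Longrightarrow>
       ((x @\<^sub>v (pv @\<^sub>v pw)) @\<^sub>v (w @\<^sub>v d)) \<bullet> (Y *\<^sub>v ((x @\<^sub>v (pv @\<^sub>v pw)) @\<^sub>v (w @\<^sub>v d))) =
       ((plant_v G x w d @\<^sub>v pv) @\<^sub>v (w @\<^sub>v pw)) \<bullet> ((plant_v G x w d @\<^sub>v pv) @\<^sub>v (w @\<^sub>v pw))"
proof -
  let ?a = "aug_dim G N" and ?r = "2 * (nw G * (N + 1))"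
  define L where "L M = lmi G N (0\<^sub>m ?a ?a) M 0" for M
  have Lc: "L M \<in> carrier_mat (lmi_dim G N) (lmi_dim G N)" for M
    unfolding L_def by (rule lmi_carrier[OF G])
  \<comment> \<open>Without storage, the multipliers \<open>I\<close> and \<open>0\<close> differ by \<open>|r|\<^sup>2\<close> in the form.\<close>
  show thesis
  proof (rule that[of "L (1\<^sub>m ?r) - L (0\<^sub>m ?r ?r)"])
    show "L (1\<^sub>m ?r) - L (0\<^sub>m ?r ?r) \<in> carrier_mat (lmi_dim G N) (lmi_dim G N)"
      by (rule minus_carrier_mat[OF Lc])
    fix x w d pv pw :: "real vec"
    assume c: "x \<in> carrier_vec (nx G)" "w \<in> carrier_vec (nw G)" "d \<in> carrier_vec (nd G)"
      "pv \<in> carrier_vec (nw G * N)" "pw \<in> carrier_vec (nw G * N)"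
    define z where "z = (x @\<^sub>v (pv @\<^sub>v pw)) @\<^sub>v (w @\<^sub>v d)"
    define r where "r = (plant_v G x w d @\<^sub>v pv) @\<^sub>v (w @\<^sub>v pw)"
    note dims = c[THEN carrier_vecD] plant_carrier[OF G, THEN carrier_vecD]
    have dz: "dim_vec z = lmi_dim G N" by (simp add: z_def dims lmi_dim_def aug_dim_def)
    have r: "r \<in> carrier_vec ?r" by (auto intro!: carrier_vecI simp: r_def dims)
    have form: "z \<bullet> (L M *\<^sub>v z) = z \<bullet> (L (0\<^sub>m ?r ?r) *\<^sub>v z) - r \<bullet> (0\<^sub>m ?r ?r *\<^sub>v r) + r \<bullet> (M *\<^sub>v r)"
      if "M \<in> carrier_mat ?r ?r" for M
      unfolding L_def z_def r_def
      by (subst (1 2) lmi_form[OF G _ _ c c]) (use that in simp_all)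
    have "z \<bullet> ((L (1\<^sub>m ?r) - L (0\<^sub>m ?r ?r)) *\<^sub>v z) = z \<bullet> (L (1\<^sub>m ?r) *\<^sub>v z) - z \<bullet> (L (0\<^sub>m ?r ?r) *\<^sub>v z)"
      by (simp add: mat_vec_dim_simps dz Lc[THEN carrier_matD(1)] Lc[THEN carrier_matD(2)])
    also have "\<dots> = r \<bullet> r"
      using form[of "1\<^sub>m ?r"] one_mult_mat_vec[OF r] r by (simp add: zero_mat_form)
    finally show "z \<bullet> ((L (1\<^sub>m ?r) - L (0\<^sub>m ?r ?r)) *\<^sub>v z) = r \<bullet> r" .
  qed
qed

section \<open>From the comparison of forms to certificates\<close>

lemma vec_last_self_le: "n \<le> dim_vec y \<Longrightarrow> vec_last y n \<bullet> vec_last y n \<le> (y :: real vec) \<bullet> y"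
proof -
  assume "n \<le> dim_vec y"
  then have "y \<in> carrier_vec ((dim_vec y - n) + n)" by (intro carrier_vecI) simp
  note y = vec_first_last_append[OF this]
  have "y \<bullet> y = (vec_first y (dim_vec y - n) @\<^sub>v vec_last y n) \<bullet> (vec_first y (dim_vec y - n) @\<^sub>v vec_last y n)"
    unfolding y ..
  also have "\<dots> = vec_first y (dim_vec y - n) \<bullet> vec_first y (dim_vec y - n) + vec_last y n \<bullet> vec_last y n"
    by (rule scalar_prod_append_dim) simp_all
  finally show ?thesis using scalar_prod_self_nonneg[of "vec_first y (dim_vec y - n)"] by simp
qed

lemma relu_iqc_carrier:
  assumes "M \<in> relu_iqc m N"
  shows "M \<in> carrier_mat (2 * (m * (N + 1))) (2 * (m * (N + 1)))"
  using assms by (auto simp: relu_iqc_def iqc_blocks_def arrow_mat_def intro!: carrier_matI)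

lemma append_vec_zero_iff:
  fixes u t :: "real vec"
  assumes "u \<in> carrier_vec a" "t \<in> carrier_vec b"
  shows "u @\<^sub>v t = 0\<^sub>v (a + b) \<longleftrightarrow> u = 0\<^sub>v a \<and> t = 0\<^sub>v b"
proof -
  have "0\<^sub>v (a + b) = 0\<^sub>v a @\<^sub>v (0\<^sub>v b :: real vec)" by (intro eq_vecI) auto
  then show ?thesis using append_vec_eq[OF assms(1) zero_carrier_vec] by simp
qed

text \<open>Used contrapositively: a vector with a nonzero entry outside \<open>new_delays\<close>
  has a nonzero part in the old coordinates, where the inequality at horizon \<open>N\<close> is
  strict.\<close>

lemma old_coordinates_zero:
  assumes c: "nv \<in> carrier_vec (nw G)" "nu \<in> carrier_vec (nw G)"
    and i: "i < lmi_dim G (Suc N)" "i \<notin> new_delays G N"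
  defines "q \<equiv> nw G * N"
  shows "((0\<^sub>v (nx G) @\<^sub>v ((0\<^sub>v q @\<^sub>v nv) @\<^sub>v (0\<^sub>v q @\<^sub>v nu))) @\<^sub>v (0\<^sub>v (nw G) @\<^sub>v 0\<^sub>v (nd G))) $ i = (0 :: real)"
proof (cases "i < nx G + 2 * (q + nw G)")
  case True
  note [simp] = c[THEN carrier_vecD]
  show ?thesis
    using i(2) by (cases rule: regroup_cases[OF True]) (simp_all add: new_delays_def q_def algebra_simps)
next
  case False
  with i(1) show ?thesis
    using c[THEN carrier_vecD] by (auto simp: lmi_dim_def aug_dim_def q_def algebra_simps)
qed

text \<open>The definiteness claims about \<open>L'\<close> all rest on one estimate, uniform in
  \<epsilon> \<ge> 0. At \<epsilon> = 0 it gives semidefiniteness and strictness off the new delays;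
  for small \<epsilon> > 0 it gives strictness everywhere.\<close>

lemma certificate_extend:
  assumes G: "is_lti G" and cert: "certificate G N \<gamma> P M"
  defines "P' \<equiv> \<lambda>\<epsilon>. extend_P G N P (\<epsilon> \<cdot>\<^sub>m 1\<^sub>m (2 * nw G))" and "M' \<equiv> extend_M G N M"
  defines "L' \<equiv> \<lambda>\<epsilon>. lmi G (Suc N) (P' \<epsilon>) M' (\<gamma>\<^sup>2)"
  shows "\<And>\<epsilon>. \<epsilon> \<ge> 0 \<Longrightarrow> pos_semidef (aug_dim G (Suc N)) (P' \<epsilon>)"
    and "M' \<in> relu_iqc (nw G) (Suc N)"
    and "neg_semidef (lmi_dim G (Suc N)) (L' 0)"
    and "\<And>z i. z \<in> carrier_vec (lmi_dim G (Suc N)) \<Longrightarrow> i < lmi_dim G (Suc N) \<Longrightarrow> i \<notin> new_delays G N \<Longrightarrow>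
           z $ i \<noteq> 0 \<Longrightarrow> z \<bullet> (L' 0 *\<^sub>v z) < 0"
    and "\<exists>\<epsilon>0>0. \<forall>\<epsilon>. 0 < \<epsilon> \<and> \<epsilon> \<le> \<epsilon>0 \<longrightarrow> certificate G (Suc N) \<gamma> (P' \<epsilon>) M'"
proof -
  let ?m = "nw G" and ?q = "nw G * N" and ?n = "lmi_dim G N" and ?n' = "lmi_dim G (Suc N)"
    and ?a' = "aug_dim G (Suc N)"
  have P: "P \<in> carrier_mat (aug_dim G N) (aug_dim G N)" "P\<^sup>T = P"
    "\<And>y. y \<in> carrier_vec (aug_dim G N) \<Longrightarrow> y \<bullet> (P *\<^sub>v y) \<ge> 0"
    and M: "M \<in> relu_iqc ?m N" and L: "neg_def ?n (lmi G N P M (\<gamma>\<^sup>2))"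
    using cert by (auto simp: certificate_def pos_semidef_def)
  have P1: "P \<in> carrier_mat (nx G + 2 * ?q) (nx G + 2 * ?q)" using P by (simp add: aug_dim_def)
  have a': "nx G + 2 * (?q + ?m) = ?a'" by (simp add: aug_dim_def algebra_simps)
  have P'c: "P' \<epsilon> \<in> carrier_mat ?a' ?a'" for \<epsilon>
    unfolding P'_def extend_P_def a'[symmetric] by (rule block_extend_carrier)
  have P's: "(P' \<epsilon>)\<^sup>T = P' \<epsilon>" for \<epsilon>
    unfolding P'_def extend_P_def by (rule block_extend_symmetric[OF P1 P(2)]) (auto intro!: eq_matI)
  show psd: "pos_semidef ?a' (P' \<epsilon>)" if "\<epsilon> \<ge> 0" for \<epsilon>
    unfolding pos_semidef_def
  proof (intro conjI ballI P'c P's)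
    fix y :: "real vec" assume "y \<in> carrier_vec ?a'"
    then have "y \<in> carrier_vec (nx G + ((?q + ?m) + (?q + ?m)))" by (simp only: a'[symmetric] mult_2)
    then obtain x b b' e e' where c: "x \<in> carrier_vec (nx G)" "b \<in> carrier_vec ?q" "b' \<in> carrier_vec ?m"
        "e \<in> carrier_vec ?q" "e' \<in> carrier_vec ?m" and y: "y = x @\<^sub>v ((b @\<^sub>v b') @\<^sub>v (e @\<^sub>v e'))"
      by (metis carrier_vec_splitE)
    have "x @\<^sub>v (b @\<^sub>v e) \<in> carrier_vec (aug_dim G N)"
      by (rule carrier_vecI) (simp add: c[THEN carrier_vecD] aug_dim_def)
    note P(3)[OF this]
    moreover have "y \<bullet> (P' \<epsilon> *\<^sub>v y) = (x @\<^sub>v (b @\<^sub>v e)) \<bullet> (P *\<^sub>v (x @\<^sub>v (b @\<^sub>v e))) + \<epsilon> * ((b' @\<^sub>v e') \<bullet> (b' @\<^sub>v e'))"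
      unfolding P'_def extend_P_def y
      by (rule block_extend_smult_one_form[OF P1 c])
    ultimately show "y \<bullet> (P' \<epsilon> *\<^sub>v y) \<ge> 0"
      using that scalar_prod_self_nonneg[of "b' @\<^sub>v e'"] by simp
  qed
  show M'r: "M' \<in> relu_iqc ?m (Suc N)"
    unfolding M'_def by (rule extend_M_relu_iqc[OF M])
  have M's: "M'\<^sup>T = M'" using M'r by (simp add: relu_iqc_def)
  have L'c: "L' \<epsilon> \<in> carrier_mat ?n' ?n'" for \<epsilon>
    unfolding L'_def by (rule lmi_carrier[OF G])
  have L's: "(L' \<epsilon>)\<^sup>T = L' \<epsilon>" for \<epsilon>
    unfolding L'_def by (rule lmi_symmetric[OF G P'c P's relu_iqc_carrier[OF M'r] M's])
  obtain Y where Y: "Y \<in> carrier_mat ?n ?n"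
    "\<And>x w d pv pw. x \<in> carrier_vec (nx G) \<Longrightarrow> w \<in> carrier_vec ?m \<Longrightarrow> d \<in> carrier_vec (nd G) \<Longrightarrow>
       pv \<in> carrier_vec ?q \<Longrightarrow> pw \<in> carrier_vec ?q \<Longrightarrow>
       ((x @\<^sub>v (pv @\<^sub>v pw)) @\<^sub>v (w @\<^sub>v d)) \<bullet> (Y *\<^sub>v ((x @\<^sub>v (pv @\<^sub>v pw)) @\<^sub>v (w @\<^sub>v d))) =
       ((plant_v G x w d @\<^sub>v pv) @\<^sub>v (w @\<^sub>v pw)) \<bullet> ((plant_v G x w d @\<^sub>v pv) @\<^sub>v (w @\<^sub>v pw))"
    using filter_output_form[OF G] by blast
  obtain \<delta> where \<delta>: "\<delta> > 0" "\<And>\<epsilon> z. 0 \<le> \<epsilon> \<Longrightarrow> \<epsilon> \<le> \<delta> \<Longrightarrow> z \<in> carrier_vec ?n \<Longrightarrow> z \<noteq> 0\<^sub>v ?n \<Longrightarrow>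
       z \<bullet> (lmi G N P M (\<gamma>\<^sup>2) *\<^sub>v z) + \<epsilon> * (z \<bullet> (Y *\<^sub>v z)) < 0"
    using neg_def_perturb[OF L Y(1)] by blast
  \<comment> \<open>Here \<open>z\<close> is \<open>z'\<close> with the new delays \<open>nv\<close>
    and \<open>nu\<close> deleted. The last conjunct records what remains of \<open>z'\<close> when
    its old part vanishes.\<close>
  have key: "\<exists>z nv nu. z \<in> carrier_vec ?n \<and> nv \<in> carrier_vec ?m \<and> nu \<in> carrier_vec ?m
     \<and> (\<forall>\<epsilon>\<ge>0. z' \<bullet> (L' \<epsilon> *\<^sub>v z') \<le> z \<bullet> (lmi G N P M (\<gamma>\<^sup>2) *\<^sub>v z) + \<epsilon> * (z \<bullet> (Y *\<^sub>v z))
          - \<epsilon> * ((nv @\<^sub>v nu) \<bullet> (nv @\<^sub>v nu)))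
     \<and> (z = 0\<^sub>v ?n \<longrightarrow> z' = (0\<^sub>v (nx G) @\<^sub>v ((0\<^sub>v ?q @\<^sub>v nv) @\<^sub>v (0\<^sub>v ?q @\<^sub>v nu))) @\<^sub>v (0\<^sub>v ?m @\<^sub>v 0\<^sub>v (nd G)))"
    if z'c: "z' \<in> carrier_vec ?n'" for z'
  proof -
    obtain x qv qw w d where c: "x \<in> carrier_vec (nx G)" "w \<in> carrier_vec ?m" "d \<in> carrier_vec (nd G)"
      and qc: "qv \<in> carrier_vec (?m * Suc N)" "qw \<in> carrier_vec (?m * Suc N)"
      and z': "z' = (x @\<^sub>v (qv @\<^sub>v qw)) @\<^sub>v (w @\<^sub>v d)"
      by (rule lmi_vec_splitE[OF z'c])
    have mS: "?m * Suc N = ?q + ?m" by simp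
    obtain pv nv where p: "pv \<in> carrier_vec ?q" "nv \<in> carrier_vec ?m" "qv = pv @\<^sub>v nv"
      by (rule carrier_vec_splitE[OF qc(1)[unfolded mS]])
    obtain pw nu where u: "pw \<in> carrier_vec ?q" "nu \<in> carrier_vec ?m" "qw = pw @\<^sub>v nu"
      by (rule carrier_vec_splitE[OF qc(2)[unfolded mS]])
    note c2 = p(1) u(1) and n = p(2) u(2) and q = p(3) u(3)
    define z where "z = (x @\<^sub>v (pv @\<^sub>v pw)) @\<^sub>v (w @\<^sub>v d)"
    define v where "v = plant_v G x w d"
    define t where "t = vec_last (v @\<^sub>v pv) ?m @\<^sub>v vec_last (w @\<^sub>v pw) ?m"
    have v: "v \<in> carrier_vec ?m" unfolding v_def by (rule plant_carrier[OF G])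
    note dims = c[THEN carrier_vecD] c2[THEN carrier_vecD] n[THEN carrier_vecD] v[THEN carrier_vecD]
    have zc: "z \<in> carrier_vec ?n"
      by (rule carrier_vecI) (simp add: z_def dims lmi_dim_def aug_dim_def)
    \<comment> \<open>The dropped samples are among the entries of the filter output at horizon
      \<open>N\<close>, whose squared length is the form of \<open>Y\<close>.\<close>
    have "t \<bullet> t \<le> (v @\<^sub>v pv) \<bullet> (v @\<^sub>v pv) + (w @\<^sub>v pw) \<bullet> (w @\<^sub>v pw)"
      unfolding t_def by (simp add: scalar_prod_append_dim[of "vec_last (v @\<^sub>v pv) ?m"])
        (intro add_mono vec_last_self_le, simp_all add: dims)
    also have "\<dots> = z \<bullet> (Y *\<^sub>v z)"
      unfolding z_def Y(2)[OF c c2] v_def[symmetric]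
      by (simp add: scalar_prod_append_dim[of "v @\<^sub>v pv"])
    finally have t: "t \<bullet> t \<le> z \<bullet> (Y *\<^sub>v z)" .
    have "z' \<bullet> (L' \<epsilon> *\<^sub>v z') \<le> z \<bullet> (lmi G N P M (\<gamma>\<^sup>2) *\<^sub>v z) + \<epsilon> * (z \<bullet> (Y *\<^sub>v z))
          - \<epsilon> * ((nv @\<^sub>v nu) \<bullet> (nv @\<^sub>v nu))" if "\<epsilon> \<ge> 0" for \<epsilon>
      unfolding z' q L'_def P'_def M'_def
        lmi_extend_form[OF G P(1) relu_iqc_carrier[OF M] c c2 n] z_def[symmetric] v_def[symmetric] t_def[symmetric]
      using mult_left_mono[OF t that] by simp
    moreover have "z' = (0\<^sub>v (nx G) @\<^sub>v ((0\<^sub>v ?q @\<^sub>v nv) @\<^sub>v (0\<^sub>v ?q @\<^sub>v nu))) @\<^sub>v (0\<^sub>v ?m @\<^sub>v 0\<^sub>v (nd G))"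
      if "z = 0\<^sub>v ?n"
    proof -
      have dim: "?n = (nx G + (?q + ?q)) + (?m + nd G)" by (simp add: lmi_dim_def aug_dim_def)
      have "x @\<^sub>v (pv @\<^sub>v pw) = 0\<^sub>v (nx G + (?q + ?q)) \<and> w @\<^sub>v d = 0\<^sub>v (?m + nd G)"
        using that unfolding z_def dim
        by (subst (asm) append_vec_zero_iff) (auto intro!: carrier_vecI simp: dims)
      then have "x = 0\<^sub>v (nx G) \<and> pv @\<^sub>v pw = 0\<^sub>v (?q + ?q) \<and> w = 0\<^sub>v ?m \<and> d = 0\<^sub>v (nd G)"
        using append_vec_zero_iff[OF c(1) append_carrier_vec[OF c2]] append_vec_zero_iff[OF c(2,3)]
        by blast
      then show ?thesis using append_vec_zero_iff[OF c2] by (simp add: z' q)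
    qed
    ultimately show ?thesis using zc n by blast
  qed
  note zero_form = scalar_prod_left_zero[OF mult_mat_vec_carrier[OF _ zero_carrier_vec]]
  \<comment> \<open>The last premise joins two situations: any nonzero vector when \<epsilon> > 0,
    and a nonzero old entry when \<epsilon> may be 0. If \<open>z\<close> is nonzero, the margin at
    horizon \<open>N\<close> decides; if \<open>z\<close> is zero, only the loss on the new
    coordinates is left, which needs \<epsilon> > 0.\<close>
  have strict: "z' \<bullet> (L' \<epsilon> *\<^sub>v z') < 0"
    if h: "z' \<in> carrier_vec ?n'" "0 \<le> \<epsilon>" "\<epsilon> \<le> \<delta>" "\<epsilon> > 0 \<and> z' \<noteq> 0\<^sub>v ?n' \<or> (\<exists>i<?n'. i \<notin> new_delays G N \<and> z' $ i \<noteq> 0)" for z' \<epsilon>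
  proof -
    obtain z nv nu where k: "z \<in> carrier_vec ?n" "nv \<in> carrier_vec ?m" "nu \<in> carrier_vec ?m"
      "z' \<bullet> (L' \<epsilon> *\<^sub>v z') \<le> z \<bullet> (lmi G N P M (\<gamma>\<^sup>2) *\<^sub>v z) + \<epsilon> * (z \<bullet> (Y *\<^sub>v z))
          - \<epsilon> * ((nv @\<^sub>v nu) \<bullet> (nv @\<^sub>v nu))"
      "z = 0\<^sub>v ?n \<Longrightarrow> z' = (0\<^sub>v (nx G) @\<^sub>v ((0\<^sub>v ?q @\<^sub>v nv) @\<^sub>v (0\<^sub>v ?q @\<^sub>v nu))) @\<^sub>v (0\<^sub>v ?m @\<^sub>v 0\<^sub>v (nd G))"
      using key[OF h(1)] h(2) by blast
    have nn: "\<epsilon> * ((nv @\<^sub>v nu) \<bullet> (nv @\<^sub>v nu)) \<ge> 0" using h(2) scalar_prod_self_nonneg by simp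
    show ?thesis
    proof (cases "z = 0\<^sub>v ?n")
      case False
      then show ?thesis using \<delta>(2)[OF h(2,3) k(1)] k(4) nn by linarith
    next
      case True
      note z' = k(5)[OF True]
      \<comment> \<open>A vanishing old part excludes the second alternative of the premise, so
        \<epsilon> is positive and the nonzero content of \<open>z'\<close> sits in
        \<open>nv\<close> and \<open>nu\<close>.\<close>
      have "\<not> (\<exists>i<?n'. i \<notin> new_delays G N \<and> z' $ i \<noteq> 0)"
        unfolding z' using old_coordinates_zero[OF k(2,3)] by blast
      with h(4) have e: "\<epsilon> > 0" "z' \<noteq> 0\<^sub>v ?n'" by auto
      have "nv @\<^sub>v nu \<noteq> 0\<^sub>v (?m + ?m)"
      proof
        assume "nv @\<^sub>v nu = 0\<^sub>v (?m + ?m)"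
        then have "nv = 0\<^sub>v ?m" "nu = 0\<^sub>v ?m" using append_vec_zero_iff[OF k(2,3)] by auto
        then have "z' = 0\<^sub>v ?n'"
          unfolding z' by (intro eq_vecI) (auto simp: lmi_dim_def aug_dim_def)
        with e show False by blast
      qed
      then have "(nv @\<^sub>v nu) \<bullet> (nv @\<^sub>v nu) > 0"
        by (rule scalar_prod_self_pos[rotated]) (use k in simp)
      moreover have "z \<bullet> (lmi G N P M (\<gamma>\<^sup>2) *\<^sub>v z) = 0" "z \<bullet> (Y *\<^sub>v z) = 0"
        unfolding True by (rule zero_form[OF lmi_carrier[OF G]], rule zero_form[OF Y(1)])
      ultimately show ?thesis using k(4) mult_pos_pos[OF e(1)] by fastforce
    qed
  qed
  show "z \<bullet> (L' 0 *\<^sub>v z) < 0" if "z \<in> carrier_vec ?n'" "i < ?n'" "i \<notin> new_delays G N" "z $ i \<noteq> 0" for z i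
    using strict[of z 0] that \<delta>(1) by auto
  show "neg_semidef ?n' (L' 0)"
    unfolding neg_semidef_def
  proof (intro conjI ballI L'c L's)
    fix z' :: "real vec" assume "z' \<in> carrier_vec ?n'"
    from key[OF this] obtain z nv nu where z: "z \<in> carrier_vec ?n"
      and "\<forall>\<epsilon>\<ge>0. z' \<bullet> (L' \<epsilon> *\<^sub>v z') \<le> z \<bullet> (lmi G N P M (\<gamma>\<^sup>2) *\<^sub>v z) + \<epsilon> * (z \<bullet> (Y *\<^sub>v z))
          - \<epsilon> * ((nv @\<^sub>v nu) \<bullet> (nv @\<^sub>v nu))"
      by blast
    \<comment> \<open>At \<epsilon> = 0 both correction terms vanish and the form is bounded by the
      one at horizon \<open>N\<close>.\<close>
    from this(2)[rule_format, of 0] have "z' \<bullet> (L' 0 *\<^sub>v z') \<le> z \<bullet> (lmi G N P M (\<gamma>\<^sup>2) *\<^sub>v z)"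
      by simp
    moreover have "z \<bullet> (lmi G N P M (\<gamma>\<^sup>2) *\<^sub>v z) \<le> 0"
    proof (cases "z = 0\<^sub>v ?n")
      case True
      have "z \<bullet> (lmi G N P M (\<gamma>\<^sup>2) *\<^sub>v z) = 0"
        unfolding True by (rule zero_form[OF lmi_carrier[OF G]])
      then show ?thesis by simp
    next
      case False
      then show ?thesis using L z by (auto simp: neg_def_def less_imp_le)
    qed
    ultimately show "z' \<bullet> (L' 0 *\<^sub>v z') \<le> 0" by simp
  qed
  show "\<exists>\<epsilon>0>0. \<forall>\<epsilon>. 0 < \<epsilon> \<and> \<epsilon> \<le> \<epsilon>0 \<longrightarrow> certificate G (Suc N) \<gamma> (P' \<epsilon>) M'"
  proof (intro exI[of _ \<delta>] conjI \<delta>(1) allI impI)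
    fix \<epsilon> :: real assume e: "0 < \<epsilon> \<and> \<epsilon> \<le> \<delta>"
    have "neg_def ?n' (L' \<epsilon>)"
      unfolding neg_def_def using L'c L's strict e by auto
    then show "certificate G (Suc N) \<gamma> (P' \<epsilon>) M'"
      using psd[of \<epsilon>] M'r e by (simp add: certificate_def L'_def)
  qed
qed

theorem mainTheorem4:
  fixes G :: lti
  assumes "is_lti G"
  shows "(\<forall>(N::nat) (\<gamma>::real) P M. \<gamma> \<ge> 0 \<longrightarrow> certificate G N \<gamma> P M \<longrightarrow>
      (let P' = extend_P G N P (0\<^sub>m (2 * nw G) (2 * nw G));
           M' = extend_M G N M;
           L' = lmi G (Suc N) P' M' (\<gamma>\<^sup>2)
       in pos_semidef (aug_dim G (Suc N)) P' \<and>
          M' \<in> relu_iqc (nw G) (Suc N) \<and>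
          neg_semidef (lmi_dim G (Suc N)) L' \<and>
          (\<forall>z \<in> carrier_vec (lmi_dim G (Suc N)).
             (\<exists>i < lmi_dim G (Suc N). i \<notin> new_delays G N \<and> z $ i \<noteq> 0) \<longrightarrow>
             z \<bullet> (L' *\<^sub>v z) < 0) \<and>
          (\<exists>\<epsilon>0 > 0. \<forall>\<epsilon>. 0 < \<epsilon> \<and> \<epsilon> \<le> \<epsilon>0 \<longrightarrow>
             certificate G (Suc N) \<gamma> (extend_P G N P (\<epsilon> \<cdot>\<^sub>m 1\<^sub>m (2 * nw G))) M')))
    \<and> antimono (gain_bound G)"
proof (intro conjI allI impI)
  fix N and \<gamma> :: real and P M
  assume "certificate G N \<gamma> P M"
  note ext = certificate_extend[OF assms this]
  \<comment> \<open>Zero padding is the instance \<epsilon> = 0 of the extended storage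
    matrix.\<close>
  have zero: "0 \<cdot>\<^sub>m 1\<^sub>m (2 * nw G) = (0\<^sub>m (2 * nw G) (2 * nw G) :: real mat)"
    by (intro eq_matI) auto
  show "let P' = extend_P G N P (0\<^sub>m (2 * nw G) (2 * nw G));
           M' = extend_M G N M;
           L' = lmi G (Suc N) P' M' (\<gamma>\<^sup>2)
       in pos_semidef (aug_dim G (Suc N)) P' \<and>
          M' \<in> relu_iqc (nw G) (Suc N) \<and>
          neg_semidef (lmi_dim G (Suc N)) L' \<and>
          (\<forall>z \<in> carrier_vec (lmi_dim G (Suc N)).
             (\<exists>i < lmi_dim G (Suc N). i \<notin> new_delays G N \<and> z $ i \<noteq> 0) \<longrightarrow>
             z \<bullet> (L' *\<^sub>v z) < 0) \<and>
          (\<exists>\<epsilon>0 > 0. \<forall>\<epsilon>. 0 < \<epsilon> \<and> \<epsilon> \<le> \<epsilon>0 \<longrightarrow>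
             certificate G (Suc N) \<gamma> (extend_P G N P (\<epsilon> \<cdot>\<^sub>m 1\<^sub>m (2 * nw G))) M')"
    unfolding Let_def zero[symmetric]
    using ext(1)[of 0] ext(2-5) by blast
next
  \<comment> \<open>Every admissible \<gamma> stays admissible through a certificate with positive
    \<epsilon>, so the infimum is taken over a larger set. This covers an empty set at horizon
    \<open>N\<close>, where the bound is infinite.\<close>
  have "gain_bound G (Suc N) \<le> gain_bound G N" for N
    unfolding gain_bound_def
  proof (rule Inf_superset_mono, safe)
    fix \<gamma> :: real and P M assume "\<gamma> \<ge> 0" "certificate G N \<gamma> P M"
    then show "\<exists>\<gamma>'. ereal \<gamma> = ereal \<gamma>' \<and> \<gamma>' \<ge> 0 \<and> (\<exists>P M. certificate G (Suc N) \<gamma>' P M)"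
      using certificate_extend(5)[OF assms] by blast
  qed
  then show "antimono (gain_bound G)"
    by (simp add: antimono_iff_le_Suc)
qed

end
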